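(* Let $G$ be a graph on $[n]$, let $k$ be a field and let $d$ be a positive integer. (a) If $G$ is unicyclic and $d\ge 3$, then $L_G(d)$ is a complete intersection if and only if $d\ge\Delta(G)$. (b) If $G$ is bicyclic and $d\ge 4$, then $L_G(d)$ is a complete intersection if and only if $d\ge\Delta(G)$.
   Context: Graphs are finite, simple and undirected, with vertex set $V(G)=[n]=\{1,\dots,n\}$ and edge set $E(G)$. $\Delta(G)$ is the maximal degree of a vertex of $G$. $G$ is unicyclic if it contains precisely one cycle as a subgraph, and bicyclic if it contains exactly two cycles as subgraphs. For a field $k$ and a positive integer $d$, the LSS-ideal (Lovász–Saks–Schrijver ideal) of $G$ is the ideal $$L_G(d)=L_G^k(d)=\Big(f_e^{(d)}=\sum_{\ell=1}^d x_{i\ell}x_{j\ell}\ :\ e=\{i,j\}\in E(G)\Big)$$ of the polynomial ring $S=k[x_{ij}: i\in[n],\ j\in[d]]$. An ideal $I$ is a complete intersection if the minimal number of generators of $I$ equals its height. *)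

theory Defs
  imports "HOL-Algebra.Algebra" "HOL-Library.Poly_Mapping" "HOL-Library.Extended_Nat"
begin

section \<open>Finite simple graphs\<close>

definition simple_graph :: "'v set \<Rightarrow> 'v set set \<Rightarrow> bool" where
  "simple_graph V E \<longleftrightarrow> finite V \<and> (\<forall>e\<in>E. e \<subseteq> V \<and> card e = 2)"

definition vertex_degree :: "'v set set \<Rightarrow> 'v \<Rightarrow> nat" where
  "vertex_degree E v = card {e \<in> E. v \<in> e}"

definition max_degree :: "'v set \<Rightarrow> 'v set set \<Rightarrow> nat" where
  "max_degree V E = Max (vertex_degree E ` V)"

definition is_cycle :: "'v set \<Rightarrow> 'v set set \<Rightarrow> bool" where
  "is_cycle W F \<longleftrightarrow> (\<exists>p. distinct p \<and> length p \<ge> 3 \<and> W = set p \<and>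
     F = {{p ! i, p ! (Suc i mod length p)} | i. i < length p})"

text \<open>Cycles are counted as subgraphs, so rotating or reversing a cyclic sequence of vertices
  does not yield a new cycle.\<close>

definition cycle_subgraphs :: "'v set \<Rightarrow> 'v set set \<Rightarrow> ('v set \<times> 'v set set) set" where
  "cycle_subgraphs V E = {(W, F). W \<subseteq> V \<and> F \<subseteq> E \<and> is_cycle W F}"

definition unicyclic :: "'v set \<Rightarrow> 'v set set \<Rightarrow> bool" where
  "unicyclic V E \<longleftrightarrow> card (cycle_subgraphs V E) = 1"

definition bicyclic :: "'v set \<Rightarrow> 'v set set \<Rightarrow> bool" where
  "bicyclic V E \<longleftrightarrow> card (cycle_subgraphs V E) = 2"


section \<open>Height, number of generators, complete intersections\<close>

definition prime_height :: "('a, 'b) ring_scheme \<Rightarrow> 'a set \<Rightarrow> enat" where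
  "prime_height R P = Sup {enat m | m. \<exists>Q :: nat \<Rightarrow> 'a set.
     (\<forall>i\<le>m. primeideal (Q i) R) \<and> (\<forall>i<m. Q i \<subset> Q (Suc i)) \<and> Q m = P}"

text \<open>The unit ideal has height \<open>\<infinity>\<close> and an ideal that is not finitely generated has
  \<open>\<infinity>\<close> generators, both as infima of the empty set.\<close>

definition ideal_height :: "('a, 'b) ring_scheme \<Rightarrow> 'a set \<Rightarrow> enat" where
  "ideal_height R I = Inf {prime_height R P | P. primeideal P R \<and> I \<subseteq> P}"

definition min_num_generators :: "('a, 'b) ring_scheme \<Rightarrow> 'a set \<Rightarrow> enat" where
  "min_num_generators R I =
     Inf {enat (card A) | A. finite A \<and> A \<subseteq> carrier R \<and> genideal R A = I}"

definition complete_intersection :: "('a, 'b) ring_scheme \<Rightarrow> 'a set \<Rightarrow> bool" where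
  "complete_intersection R I \<longleftrightarrow> ideal I R \<and> min_num_generators R I = ideal_height R I"


section \<open>Lovasz-Saks-Schrijver ideals\<close>

text \<open>Polynomials in the variables \<open>x\<^bsub>i,l\<^esub>\<close>, \<open>(i, l) \<in> \<nat> \<times> \<nat>\<close>: finitely supported functions
  from monomials (exponent vectors) to coefficients.\<close>

type_synonym 'k mpoly = "((nat \<times> nat) \<Rightarrow>\<^sub>0 nat) \<Rightarrow>\<^sub>0 'k"

text \<open>The ring \<open>k[x\<^bsub>i,l\<^esub> : 1 \<le> i \<le> n, 1 \<le> l \<le> d]\<close>.\<close>

definition LSS_ring :: "nat \<Rightarrow> nat \<Rightarrow> 'k::field mpoly ring" where
  "LSS_ring n d =
     \<lparr>carrier = {p. \<forall>m \<in> Poly_Mapping.keys p. Poly_Mapping.keys m \<subseteq> {1..n} \<times> {1..d}},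
      monoid.mult = (*), one = 1, ring.zero = 0, add = (+)\<rparr>"

definition var :: "nat \<Rightarrow> nat \<Rightarrow> 'k::field mpoly" where
  "var i l = Poly_Mapping.single (Poly_Mapping.single (i, l) 1) 1"

definition LSS_gen :: "nat \<Rightarrow> nat \<Rightarrow> nat \<Rightarrow> 'k::field mpoly" where
  "LSS_gen d i j = (\<Sum>l = 1..d. var i l * var j l)"

definition LSS_ideal :: "nat \<Rightarrow> nat set set \<Rightarrow> nat \<Rightarrow> 'k::field mpoly set" where
  "LSS_ideal n E d = genideal (LSS_ring n d) {LSS_gen d i j | i j. {i, j} \<in> E}"

lemma LSS_ring_simps [simp]:
  "monoid.mult (LSS_ring n d) = (*)" "monoid.one (LSS_ring n d) = 1"
  "ring.zero (LSS_ring n d) = 0" "ring.add (LSS_ring n d) = (+)"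
  by (simp_all add: LSS_ring_def)

lemma LSS_ring_carrier_iff:
  "p \<in> carrier (LSS_ring n d) \<longleftrightarrow>
     (\<forall>m \<in> Poly_Mapping.keys p. Poly_Mapping.keys m \<subseteq> {1..n} \<times> {1..d})"
  by (simp add: LSS_ring_def)

lemma LSS_ring_cring: "cring (LSS_ring n d :: 'k::field mpoly ring)"
proof -
  let ?S = "{1..n} \<times> {1..d}"
  let ?R = "LSS_ring n d :: 'k mpoly ring"
  have plus: "p + q \<in> carrier ?R" if pq: "p \<in> carrier ?R" "q \<in> carrier ?R" for p q
    unfolding LSS_ring_carrier_iff
  proof
    fix m assume "m \<in> Poly_Mapping.keys (p + q)"
    then have "m \<in> Poly_Mapping.keys p \<or> m \<in> Poly_Mapping.keys q"
      using keys_add[of p q] by blast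
    then show "Poly_Mapping.keys m \<subseteq> ?S"
      using pq unfolding LSS_ring_carrier_iff by blast
  qed
  have times: "p * q \<in> carrier ?R" if pq: "p \<in> carrier ?R" "q \<in> carrier ?R" for p q
    unfolding LSS_ring_carrier_iff
  proof
    fix m assume "m \<in> Poly_Mapping.keys (p * q)"
    then obtain a b where ab: "m = a + b" "a \<in> Poly_Mapping.keys p" "b \<in> Poly_Mapping.keys q"
      using keys_mult[of p q] by blast
    then have "Poly_Mapping.keys a \<subseteq> ?S" "Poly_Mapping.keys b \<subseteq> ?S"
      using pq unfolding LSS_ring_carrier_iff by blast+
    then show "Poly_Mapping.keys m \<subseteq> ?S"
      using keys_add[of a b] ab(1) by blast
  qed
  have zero: "0 \<in> carrier ?R" and one: "1 \<in> carrier ?R"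
    unfolding LSS_ring_carrier_iff by simp_all
  have minus: "- p \<in> carrier ?R" if "p \<in> carrier ?R" for p
    using that unfolding LSS_ring_carrier_iff by simp
  have "abelian_group ?R"
  proof (rule abelian_groupI)
    fix p assume "p \<in> carrier ?R"
    then show "\<exists>q\<in>carrier ?R. q \<oplus>\<^bsub>?R\<^esub> p = \<zero>\<^bsub>?R\<^esub>"
      using minus by (intro bexI[of _ "- p"]) simp_all
  qed (simp_all add: plus zero add.assoc add.commute)
  moreover have "comm_monoid ?R"
    by (rule comm_monoidI) (simp_all add: times one mult.assoc mult.commute)
  ultimately show ?thesis
    by (rule cringI) (simp add: distrib_right)
qed

lemma LSS_gen_in_carrier:
  assumes "i \<in> {1..n}" "j \<in> {1..n}"
  shows "(LSS_gen d i j :: 'k::field mpoly) \<in> carrier (LSS_ring n d)"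
proof -
  interpret cring "LSS_ring n d :: 'k mpoly ring" by (rule LSS_ring_cring)
  have v: "(var i l :: 'k mpoly) \<in> carrier (LSS_ring n d)"
    if "i \<in> {1..n}" "l \<in> {1..d}" for i l
    using that by (simp add: var_def LSS_ring_carrier_iff)
  have "(\<Sum>l\<in>L. var i l * var j l :: 'k mpoly) \<in> carrier (LSS_ring n d)"
    if "finite L" "L \<subseteq> {1..d}" for L
    using that
  proof (induction L rule: finite_induct)
    case empty
    show ?case using zero_closed by simp
  next
    case (insert l L)
    have l: "l \<in> {1..d}" using insert.prems by blast
    have "(\<Sum>l\<in>L. var i l * var j l :: 'k mpoly) \<in> carrier (LSS_ring n d)"
      using insert.IH insert.prems by blast
    from a_closed[OF m_closed[OF v[OF assms(1) l] v[OF assms(2) l]] this]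
    show ?case by (simp only: LSS_ring_simps sum.insert[OF insert.hyps])
  qed
  then show ?thesis unfolding LSS_gen_def by blast
qed

lemma LSS_ideal_is_ideal:
  assumes "simple_graph {1..n} E"
  shows "ideal (LSS_ideal n E d :: 'k::field mpoly set) (LSS_ring n d)"
proof -
  interpret cring "LSS_ring n d :: 'k mpoly ring" by (rule LSS_ring_cring)
  have "i \<in> {1..n} \<and> j \<in> {1..n}" if "{i, j} \<in> E" for i j
    using assms that unfolding simple_graph_def by blast
  then show ?thesis
    unfolding LSS_ideal_def by (intro genideal_ideal) (auto intro!: LSS_gen_in_carrier)
qed

end

theory Submission
  imports Defs "HOL-Library.Product_Lexorder" "HOL-Computational_Algebra.Polynomial_Factorial"
begin

text \<open>Write \<open>f\<^sub>e\<close> for the generator that belongs to the edge \<open>e\<close> and \<open>L\<close> for the ideal generated by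
  all of them, in \<open>N = n d\<close> variables.  The \<open>f\<^sub>e\<close> are quadratic forms without common monomials, so
  \<open>L\<close> needs \<open>|E|\<close> generators (\<open>min_num_generators_LSS_ideal\<close>), and the claim is that \<open>L\<close> has
  height \<open>|E|\<close> exactly when \<open>d\<close> is at least the maximal degree.

  The height is bounded from above, for an arbitrary graph, by one explicit prime containing \<open>L\<close>.  A zero
  of \<open>L\<close> assigns to the vertices vectors of length \<open>d\<close> that are orthogonal along the edges.  Choose
  them one vertex after the other, over the field of rational functions: the vector of \<open>v\<close> has to
  solve one linear equation for each neighbour treated before, so at least \<open>d\<close> minus their number of its
  coordinates can be kept as independent variables.  This is a homomorphism that kills \<open>L\<close> and is the identity
  on a set \<open>U\<close> of at least \<open>N - |E|\<close> variables, and its kernel has height at most \<open>N - |U|\<close>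
  (\<open>prime_height_le\<close>), that is, at most \<open>|E|\<close>.  If some vertex has degree greater than \<open>d\<close>, let its
  vector be zero instead: this loses \<open>d\<close> variables, but it makes more than \<open>d\<close> equations trivial,
  and the height comes out smaller than \<open>|E|\<close>.  Hence a complete intersection forces \<open>d\<close> to be at least
  the maximal degree.

  The bound on the height of a prime comes from a count of monomials.  Given a chain of primes of length \<open>m\<close> that ends in \<open>P\<close>,
  pick an element of each step.  If \<open>m + |U| > N\<close>, these elements and the variables
  in \<open>U\<close> are algebraically dependent (\<open>algebraic_dependence\<close>), and going up the chain
  removes the chosen elements from the relation one by one, until a nonzero polynomial in the variables
  \<open>U\<close> is left in \<open>P\<close> (\<open>prime_chain_peel\<close>).

  For the lower bound, suppose that weights of the variables and a proper edge colouring with colours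
  \<open>1,\<dots>,d\<close> are such that the term \<open>x\<^bsub>i,c\<^esub> x\<^bsub>j,c\<^esub>\<close>, with \<open>c\<close> the colour of \<open>{i, j}\<close>, is the heaviest of
  its generator.  Then the initial monomials are pairwise coprime, so the generators form a regular sequence
  (\<open>coprime_initial_monomials_regular\<close>), and every prime containing a regular sequence of length \<open>r\<close>
  is the end of a chain of length \<open>r\<close> (\<open>prime_height_ge_regular_sequence\<close>).

  Colouring and weights are built by induction on the edges (\<open>exists_positive_edge_colouring\<close>).
  A pendant edge is coloured with a colour that is free at its inner end, and that colour is made very heavy at the
  leaf.  If there is no leaf, the inequality \<open>|E| + 1 \<le> |V| + #cycles\<close> leaves so little room for
  vertices of degree above \<open>2\<close> that, with at most two cycles, some edge joins two vertices of degree \<open>2\<close>; it is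
  removed together with the two edges next to it.  Putting these three edges back takes three different
  colours; if no degree exceeds \<open>d\<close>, they are available as soon as \<open>d \<ge> 3\<close> and \<open>d \<ge> #cycles + 2\<close>.  This
  is where the bounds \<open>3\<close> and \<open>4\<close> come from.\<close>


section \<open>Homogeneous linear systems\<close>

text \<open>Every equation costs at most one free unknown.  The solutions \<open>W j\<close> restrict to the identity matrix on
  the free unknowns \<open>L\<close>; if \<open>W i\<close> violates a new equation, then \<open>i\<close> is given up and
  multiples of \<open>W i\<close> correct the other solutions.\<close>

lemma linear_system_free_unknowns:
  fixes M :: "'y \<Rightarrow> 'x \<Rightarrow> 'k::field"
  assumes "finite J" "finite Y"
  obtains L where "L \<subseteq> J" "card J \<le> card L + card Y"
    "\<And>t. \<exists>s. (\<forall>x\<in>L. s x = t x) \<and> (\<forall>y\<in>Y. (\<Sum>x\<in>J. M y x * s x) = 0)"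
proof -
  have "\<exists>L W. L \<subseteq> J \<and> card J \<le> card L + card Y
      \<and> (\<forall>j\<in>L. \<forall>x\<in>L. W j x = (if x = j then 1 else 0))
      \<and> (\<forall>j\<in>L. \<forall>y\<in>Y. (\<Sum>x\<in>J. M y x * W j x) = 0)"
    using assms(2)
  proof (induction Y rule: finite_induct)
    case empty
    show ?case by (intro exI[of _ J] exI[of _ "\<lambda>j x. if x = j then 1 else 0"]) auto
  next
    case (insert y Y)
    then obtain L W where LW: "L \<subseteq> J" "card J \<le> card L + card Y"
      "\<And>j x. j \<in> L \<Longrightarrow> x \<in> L \<Longrightarrow> W j x = (if x = j then 1 else 0)"
      "\<And>j y. j \<in> L \<Longrightarrow> y \<in> Y \<Longrightarrow> (\<Sum>x\<in>J. M y x * W j x) = 0" by blast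
    define c where "c j = (\<Sum>x\<in>J. M y x * W j x)" for j
    show ?case
    proof (cases "\<forall>j\<in>L. c j = 0")
      case True
      then show ?thesis using LW insert.hyps
        by (intro exI[of _ L] exI[of _ W]) (auto simp: c_def)
    next
      case False
      then obtain i where i: "i \<in> L" "c i \<noteq> 0" by blast
      define W' where "W' j x = W j x - c j / c i * W i x" for j x
      have sum: "(\<Sum>x\<in>J. M z x * W' j x)
          = (\<Sum>x\<in>J. M z x * W j x) - c j / c i * (\<Sum>x\<in>J. M z x * W i x)" for z j
        unfolding W'_def by (simp add: algebra_simps sum_subtractf sum_distrib_left)
      have fin: "finite L" using LW(1) assms(1) finite_subset by blast
      show ?thesis
      proof (intro exI[of _ "L - {i}"] exI[of _ W'] conjI ballI)
        show "card J \<le> card (L - {i}) + card (insert y Y)"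
          using LW(2) i(1) insert.hyps card_Suc_Diff1[OF fin i(1)] by simp
        fix j z assume j: "j \<in> L - {i}" and z: "z \<in> insert y Y"
        show "(\<Sum>x\<in>J. M z x * W' j x) = 0"
        proof (cases "z = y")
          case True
          then show ?thesis unfolding sum using i(2) by (simp flip: c_def)
        next
          case False
          then show ?thesis unfolding sum using LW(4) i(1) j z by simp
        qed
      next
        fix j x assume "j \<in> L - {i}" "x \<in> L - {i}"
        then show "W' j x = (if x = j then 1 else 0)"
          using LW(3) i(1) by (simp add: W'_def)
      qed (use LW(1) in blast)
    qed
  qed
  then obtain L W where LW: "L \<subseteq> J" "card J \<le> card L + card Y"
    "\<And>j x. j \<in> L \<Longrightarrow> x \<in> L \<Longrightarrow> W j x = (if x = j then 1 else 0)"
    "\<And>j y. j \<in> L \<Longrightarrow> y \<in> Y \<Longrightarrow> (\<Sum>x\<in>J. M y x * W j x) = 0" by blast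
  have fin: "finite L" using LW(1) assms(1) finite_subset by blast
  have "\<exists>s. (\<forall>x\<in>L. s x = t x) \<and> (\<forall>y\<in>Y. (\<Sum>x\<in>J. M y x * s x) = 0)" for t
  proof (intro exI[of _ "\<lambda>x. \<Sum>j\<in>L. t j * W j x"] conjI ballI)
    fix x assume x: "x \<in> L"
    have "(\<Sum>j\<in>L. t j * W j x) = (\<Sum>j\<in>L. if x = j then t j else 0)"
      by (rule sum.cong) (use x LW(3) in auto)
    then show "(\<Sum>j\<in>L. t j * W j x) = t x" using fin x by simp
  next
    fix y assume y: "y \<in> Y"
    have "(\<Sum>x\<in>J. M y x * (\<Sum>j\<in>L. t j * W j x)) = (\<Sum>j\<in>L. t j * (\<Sum>x\<in>J. M y x * W j x))"
      unfolding sum_distrib_left by (subst sum.swap) (simp add: mult_ac)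
    also have "\<dots> = 0" using LW(4) y by simp
    finally show "(\<Sum>x\<in>J. M y x * (\<Sum>j\<in>L. t j * W j x)) = 0" .
  qed
  with LW(1,2) show thesis using that by blast
qed

corollary linear_system_nontrivial:
  fixes M :: "'y \<Rightarrow> 'x \<Rightarrow> 'k::field"
  assumes "finite J" "finite Y" "card Y < card J"
  obtains s where "\<exists>x\<in>J. s x \<noteq> 0" "\<And>y. y \<in> Y \<Longrightarrow> (\<Sum>x\<in>J. M y x * s x) = 0"
proof -
  obtain L where L: "L \<subseteq> J" "card J \<le> card L + card Y"
    "\<And>t. \<exists>s. (\<forall>x\<in>L. s x = t x) \<and> (\<forall>y\<in>Y. (\<Sum>x\<in>J. M y x * s x) = 0)"
    by (rule linear_system_free_unknowns[OF assms(1,2), of M]) (rule that)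
  from L(2) assms(3) have "L \<noteq> {}" by auto
  moreover obtain s where s: "\<forall>x\<in>L. s x = 1" "\<forall>y\<in>Y. (\<Sum>x\<in>J. M y x * s x) = 0"
    using L(3)[of "\<lambda>_. 1"] by blast
  ultimately have "\<exists>x\<in>J. s x \<noteq> 0" using L(1) by (metis all_not_in_conv subset_iff zero_neq_one)
  then show thesis using that s(2) by blast
qed


section \<open>Polynomials in a given set of variables\<close>

lemma poly_mapping_eq_sum_single:
  "p = (\<Sum>m\<in>Poly_Mapping.keys p. Poly_Mapping.single m (Poly_Mapping.lookup p m))"
proof (rule poly_mapping_eqI)
  fix k
  show "Poly_Mapping.lookup p k = Poly_Mapping.lookup
      (\<Sum>m\<in>Poly_Mapping.keys p. Poly_Mapping.single m (Poly_Mapping.lookup p m)) k"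
    by (auto simp: lookup_sum lookup_single when_def in_keys_iff)
qed

lemma poly_induct [case_names zero single add]:
  fixes p :: "'m \<Rightarrow>\<^sub>0 'k::comm_monoid_add"
  assumes "P 0" "\<And>m c. m \<in> Poly_Mapping.keys p \<Longrightarrow> P (Poly_Mapping.single m c)"
    "\<And>p q. P p \<Longrightarrow> P q \<Longrightarrow> P (p + q)"
  shows "P p"
proof -
  have "P (\<Sum>m\<in>F. Poly_Mapping.single m (Poly_Mapping.lookup p m))"
    if "finite F" "F \<subseteq> Poly_Mapping.keys p" for F
    using that by (induction F rule: finite_induct) (auto intro: assms)
  then show ?thesis using poly_mapping_eq_sum_single[of p] by (metis finite_keys order_refl)
qed

definition polys_in :: "'v set \<Rightarrow> (('v \<Rightarrow>\<^sub>0 nat) \<Rightarrow>\<^sub>0 'k::comm_ring_1) set" where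
  "polys_in A = {p. \<forall>m\<in>Poly_Mapping.keys p. Poly_Mapping.keys m \<subseteq> A}"

lemma carrier_LSS_ring: "carrier (LSS_ring n d) = polys_in ({1..n} \<times> {1..d})"
  by (simp add: LSS_ring_def polys_in_def)

abbreviation const :: "'k \<Rightarrow> ('v \<Rightarrow>\<^sub>0 nat) \<Rightarrow>\<^sub>0 'k::comm_ring_1" where
  "const c \<equiv> Poly_Mapping.single 0 c"

lemma lookup_const_times:
  "Poly_Mapping.lookup (const c * p) m = c * Poly_Mapping.lookup p m"
proof -
  have "const c * p = Poly_Mapping.map ((*) c) p" by (rule mult_map_scale_conv_mult[symmetric])
  then show ?thesis by (simp add: map.rep_eq when_def)
qed

lemma polys_in_const [simp]: "const c \<in> polys_in A"
  by (simp add: polys_in_def)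

lemma polys_in_add: "p \<in> polys_in A \<Longrightarrow> q \<in> polys_in A \<Longrightarrow> p + q \<in> polys_in A"
  unfolding polys_in_def using keys_add[of p q] by blast

lemma polys_in_times:
  assumes "p \<in> polys_in A" "q \<in> polys_in A" shows "p * q \<in> polys_in A"
  unfolding polys_in_def
proof (intro CollectI ballI)
  fix m assume "m \<in> Poly_Mapping.keys (p * q)"
  then obtain a b where "m = a + b" "a \<in> Poly_Mapping.keys p" "b \<in> Poly_Mapping.keys q"
    using keys_mult[of p q] by blast
  then show "Poly_Mapping.keys m \<subseteq> A"
    using assms keys_add[of a b] unfolding polys_in_def by blast
qed

lemma polys_in_uminus: "p \<in> polys_in A \<Longrightarrow> - p \<in> polys_in A"
  by (simp add: polys_in_def)

lemma polys_in_zero [simp]: "0 \<in> polys_in A" and polys_in_one [simp]: "1 \<in> polys_in A"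
  by (simp_all add: polys_in_def)

lemma polys_in_sum: "(\<And>x. x \<in> F \<Longrightarrow> f x \<in> polys_in A) \<Longrightarrow> sum f F \<in> polys_in A"
  by (induction F rule: infinite_finite_induct) (auto intro: polys_in_add)

lemma polys_in_prod: "(\<And>x. x \<in> F \<Longrightarrow> f x \<in> polys_in A) \<Longrightarrow> prod f F \<in> polys_in A"
  by (induction F rule: infinite_finite_induct) (auto intro: polys_in_times)

lemma polys_in_power: "p \<in> polys_in A \<Longrightarrow> p ^ k \<in> polys_in A"
  by (induction k) (auto intro: polys_in_times)


section \<open>Algebraic dependence\<close>

definition bounded_monomials :: "'v set \<Rightarrow> nat \<Rightarrow> ('v \<Rightarrow>\<^sub>0 nat) set" where
  "bounded_monomials A b =
     {m. Poly_Mapping.keys m \<subseteq> A \<and> (\<forall>x. Poly_Mapping.lookup m x \<le> b)}"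

lemma bounded_monomials_card:
  assumes "finite A"
  shows "finite (bounded_monomials A b)" "card (bounded_monomials A b) \<le> Suc b ^ card A"
proof -
  let ?r = "\<lambda>m. restrict (Poly_Mapping.lookup m) A"
  have inj: "inj_on ?r (bounded_monomials A b)"
  proof (rule inj_onI)
    fix m m' assume m: "m \<in> bounded_monomials A b" "m' \<in> bounded_monomials A b"
      and eq: "?r m = ?r m'"
    show "m = m'"
    proof (rule poly_mapping_eqI)
      fix x
      show "Poly_Mapping.lookup m x = Poly_Mapping.lookup m' x"
      proof (cases "x \<in> A")
        case True
        then show ?thesis using fun_cong[OF eq, of x] by simp
      next
        case False
        then show ?thesis using m unfolding bounded_monomials_def in_keys_iff subset_iff
          by (metis (mono_tags, lifting) in_keys_iff mem_Collect_eq)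
      qed
    qed
  qed
  have sub: "?r ` bounded_monomials A b \<subseteq> A \<rightarrow>\<^sub>E {..b}"
    by (auto simp: bounded_monomials_def)
  have fin: "finite (A \<rightarrow>\<^sub>E {..b})" using assms by (intro finite_PiE) auto
  show "finite (bounded_monomials A b)"
    using inj sub fin by (metis finite_imageD finite_subset)
  show "card (bounded_monomials A b) \<le> Suc b ^ card A"
    using card_inj_on_le[OF inj sub fin] assms by (simp add: card_PiE)
qed

lemma bounded_monomials_add:
  "m \<in> bounded_monomials A b \<Longrightarrow> m' \<in> bounded_monomials A b' \<Longrightarrow>
     m + m' \<in> bounded_monomials A (b + b')"
  using keys_add[of m m'] by (auto simp: bounded_monomials_def lookup_add intro: add_mono)

lemma keys_times_bounded:
  assumes "Poly_Mapping.keys p \<subseteq> bounded_monomials A b" "Poly_Mapping.keys q \<subseteq> bounded_monomials A b'"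
  shows "Poly_Mapping.keys (p * q) \<subseteq> bounded_monomials A (b + b')"
  using keys_mult[of p q] bounded_monomials_add assms by blast

lemma keys_one_bounded: "Poly_Mapping.keys (1 :: ('v \<Rightarrow>\<^sub>0 nat) \<Rightarrow>\<^sub>0 'k::comm_ring_1) \<subseteq> bounded_monomials A 0"
  by (simp add: bounded_monomials_def)

lemma keys_power_bounded:
  assumes "Poly_Mapping.keys p \<subseteq> bounded_monomials A b"
  shows "Poly_Mapping.keys (p ^ k) \<subseteq> bounded_monomials A (k * b)"
proof (induction k)
  case 0
  show ?case using keys_one_bounded by simp
next
  case (Suc k)
  then show ?case using keys_times_bounded[OF assms Suc] by simp
qed

lemma keys_prod_bounded:
  assumes "finite I" "\<And>i. i \<in> I \<Longrightarrow> Poly_Mapping.keys (f i) \<subseteq> bounded_monomials A b"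
  shows "Poly_Mapping.keys (prod f I) \<subseteq> bounded_monomials A (card I * b)"
  using assms
proof (induction I rule: finite_induct)
  case empty
  show ?case using keys_one_bounded by simp
next
  case (insert i I)
  have "Poly_Mapping.keys (f i * prod f I) \<subseteq> bounded_monomials A (b + card I * b)"
    by (rule keys_times_bounded) (use insert in auto)
  then show ?case using insert.hyps by simp
qed

lemma bounded_monomials_mono: "b \<le> b' \<Longrightarrow> bounded_monomials A b \<subseteq> bounded_monomials A b'"
  by (auto simp: bounded_monomials_def intro: order_trans)

text \<open>Products of powers of the \<open>h i\<close> with exponents below \<open>D\<close> number \<open>D ^ card I\<close>, while the monomials occurring in
  them number at most a constant times \<open>D ^ card A\<close>.  For large \<open>D\<close> this leaves more unknown
  coefficients than linear conditions.  The exponent vectors are taken extensional, so that different ones differ at an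
  element of \<open>I\<close>.\<close>

theorem algebraic_dependence:
  fixes h :: "'i \<Rightarrow> ('v \<Rightarrow>\<^sub>0 nat) \<Rightarrow>\<^sub>0 'k::field"
  assumes "finite I" "finite A" "card A < card I" "\<And>i. i \<in> I \<Longrightarrow> h i \<in> polys_in A"
  obtains B a where "finite B" "B \<noteq> {}" "B \<subseteq> extensional I" "\<And>\<gamma>. \<gamma> \<in> B \<Longrightarrow> a \<gamma> \<noteq> 0"
    "(\<Sum>\<gamma>\<in>B. const (a \<gamma>) * (\<Prod>i\<in>I. h i ^ \<gamma> i)) = 0"
proof -
  define ms where "ms = (\<Union>i\<in>I. Poly_Mapping.keys (h i))"
  define e where "e = (\<Sum>m\<in>ms. \<Sum>x\<in>A. Poly_Mapping.lookup m x)"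
  have ms: "finite ms" using assms(1) by (simp add: ms_def)
  have he: "Poly_Mapping.keys (h i) \<subseteq> bounded_monomials A e" if i: "i \<in> I" for i
  proof
    fix m assume m: "m \<in> Poly_Mapping.keys (h i)"
    have k: "Poly_Mapping.keys m \<subseteq> A" using assms(4)[OF i] m by (auto simp: polys_in_def)
    moreover have "Poly_Mapping.lookup m x \<le> e" for x
    proof (cases "x \<in> A")
      case True
      have "Poly_Mapping.lookup m x \<le> (\<Sum>x\<in>A. Poly_Mapping.lookup m x)"
        using member_le_sum[OF True, of "Poly_Mapping.lookup m"] assms(2) by simp
      also have "\<dots> \<le> e" unfolding e_def
        by (rule member_le_sum[of m ms "\<lambda>m. \<Sum>x\<in>A. Poly_Mapping.lookup m x"])
          (use m i ms in \<open>auto simp: ms_def\<close>)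
      finally show ?thesis .
    next
      case False
      then show ?thesis using k by (metis in_keys_iff le0 subset_iff)
    qed
    ultimately show "m \<in> bounded_monomials A e" by (simp add: bounded_monomials_def)
  qed
  define C where "C = card I * e + 1"
  \<comment> \<open>The least \<open>D\<close> with \<open>(C * D) ^ card A < D ^ Suc (card A)\<close>.\<close>
  define D where "D = Suc (C ^ card A)"
  define \<Gamma> where "\<Gamma> = I \<rightarrow>\<^sub>E {..<D}"
  define Y where "Y = bounded_monomials A (card I * (D * e))"
  have fin: "finite \<Gamma>" "finite Y"
    using assms(1,2) bounded_monomials_card by (auto simp: \<Gamma>_def Y_def intro!: finite_PiE)
  have "card Y \<le> Suc (card I * (D * e)) ^ card A"
    unfolding Y_def by (rule bounded_monomials_card[OF assms(2)])
  also have "\<dots> \<le> (C * D) ^ card A"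
    by (rule power_mono) (simp_all add: C_def D_def algebra_simps)
  also have "\<dots> = C ^ card A * D ^ card A" by (rule power_mult_distrib)
  also have "\<dots> < D * D ^ card A" by (simp add: D_def)
  also have "\<dots> \<le> D ^ card I"
    using power_increasing[of "Suc (card A)" "card I" D] assms(3) by (simp add: D_def)
  also have "\<dots> = card \<Gamma>" using assms(1) by (simp add: \<Gamma>_def card_PiE)
  finally have card: "card Y < card \<Gamma>" .
  define H where "H \<gamma> = (\<Prod>i\<in>I. h i ^ \<gamma> i)" for \<gamma> :: "'i \<Rightarrow> nat"
  have H: "Poly_Mapping.keys (H \<gamma>) \<subseteq> Y" if "\<gamma> \<in> \<Gamma>" for \<gamma>
    unfolding H_def Y_def
  proof (rule keys_prod_bounded[OF assms(1)])
    fix i assume i: "i \<in> I"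
    then have "\<gamma> i \<le> D" using that by (auto simp: \<Gamma>_def PiE_def Pi_def intro: less_imp_le)
    then have "\<gamma> i * e \<le> D * e" by simp
    with keys_power_bounded[OF he[OF i], of "\<gamma> i"]
    show "Poly_Mapping.keys (h i ^ \<gamma> i) \<subseteq> bounded_monomials A (D * e)"
      using bounded_monomials_mono by blast
  qed
  obtain a where a: "\<exists>\<gamma>\<in>\<Gamma>. a \<gamma> \<noteq> 0"
    "\<And>y. y \<in> Y \<Longrightarrow> (\<Sum>\<gamma>\<in>\<Gamma>. Poly_Mapping.lookup (H \<gamma>) y * a \<gamma>) = 0"
    using linear_system_nontrivial[OF fin card, of "\<lambda>y \<gamma>. Poly_Mapping.lookup (H \<gamma>) y"] by metis
  define B where "B = {\<gamma>\<in>\<Gamma>. a \<gamma> \<noteq> 0}"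
  have z: "(\<Sum>\<gamma>\<in>\<Gamma>. const (a \<gamma>) * H \<gamma>) = 0"
  proof (rule poly_mapping_eqI)
    fix y
    have "Poly_Mapping.lookup (\<Sum>\<gamma>\<in>\<Gamma>. const (a \<gamma>) * H \<gamma>) y
        = (\<Sum>\<gamma>\<in>\<Gamma>. Poly_Mapping.lookup (H \<gamma>) y * a \<gamma>)"
      by (simp only: lookup_sum lookup_const_times) (simp add: mult.commute)
    also have "\<dots> = 0"
    proof (cases "y \<in> Y")
      case False
      then have "Poly_Mapping.lookup (H \<gamma>) y = 0" if "\<gamma> \<in> \<Gamma>" for \<gamma>
        using H[OF that] by (auto simp: in_keys_iff)
      then show ?thesis by simp
    qed (rule a(2))
    finally show "Poly_Mapping.lookup (\<Sum>\<gamma>\<in>\<Gamma>. const (a \<gamma>) * H \<gamma>) y = Poly_Mapping.lookup 0 y"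
      by simp
  qed
  have "(\<Sum>\<gamma>\<in>B. const (a \<gamma>) * H \<gamma>) = 0"
    using z by (subst sum.mono_neutral_left[of \<Gamma>]) (auto simp: B_def fin)
  moreover have "finite B" using fin(1) by (simp add: B_def)
  moreover have "B \<noteq> {}" "B \<subseteq> extensional I"
    using a(1) by (auto simp: B_def \<Gamma>_def PiE_def)
  ultimately show thesis by (intro that[of B a]) (simp_all add: B_def H_def)
qed


section \<open>Chains of primes and algebraically independent variables\<close>

text \<open>The operations of the ring record are those of the polynomial type; stated for the latter, membership in a prime
  is accessible to ordinary rewriting.\<close>

lemma primeideal_LSS_ringD:
  fixes P :: "'k::field mpoly set"
  assumes "primeideal P (LSS_ring n d)"
  shows "0 \<in> P" "P \<subseteq> carrier (LSS_ring n d)" "1 \<notin> P"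
    and "\<And>p q. p \<in> P \<Longrightarrow> q \<in> P \<Longrightarrow> p + q \<in> P"
    and "\<And>p. p \<in> P \<Longrightarrow> - p \<in> P"
    and "\<And>p q. p \<in> P \<Longrightarrow> q \<in> P \<Longrightarrow> p - q \<in> P"
    and "\<And>p q. p \<in> P \<Longrightarrow> q \<in> carrier (LSS_ring n d) \<Longrightarrow> p * q \<in> P"
    and "\<And>p q. p \<in> P \<Longrightarrow> q \<in> carrier (LSS_ring n d) \<Longrightarrow> q * p \<in> P"
    and "\<And>p q. p \<in> carrier (LSS_ring n d) \<Longrightarrow> q \<in> carrier (LSS_ring n d)
           \<Longrightarrow> p * q \<in> P \<Longrightarrow> p \<in> P \<or> q \<in> P"
    and "\<And>(F :: 'i set) f. (\<And>x. x \<in> F \<Longrightarrow> f x \<in> P) \<Longrightarrow> sum f F \<in> P"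
    and "\<And>p k. p \<in> carrier (LSS_ring n d) \<Longrightarrow> p ^ k \<in> P \<Longrightarrow> p \<in> P"
proof -
  interpret primeideal P "LSS_ring n d :: 'k mpoly ring" by (rule assms)
  have ag: "additive_subgroup P (LSS_ring n d)" by (rule is_additive_subgroup)
  show z: "0 \<in> P" using additive_subgroup.zero_closed[OF ag] by simp
  show sub: "P \<subseteq> carrier (LSS_ring n d)" by (rule a_subset)
  show one: "1 \<notin> P" using I_notcarr one_imp_carrier by auto
  show add: "p + q \<in> P" if "p \<in> P" "q \<in> P" for p q using additive_subgroup.a_closed[OF ag that] by simp
  show mul: "p * q \<in> P" if "p \<in> P" "q \<in> carrier (LSS_ring n d)" for p q
    using I_r_closed[OF that] by simp
  show "q * p \<in> P" if "p \<in> P" "q \<in> carrier (LSS_ring n d)" for p q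
    using I_l_closed[OF that] by simp
  show neg: "- p \<in> P" if "p \<in> P" for p
  proof -
    have "- (1::'k mpoly) \<in> carrier (LSS_ring n d)"
      by (simp add: carrier_LSS_ring polys_in_uminus)
    from mul[OF that this] show ?thesis by simp
  qed
  show "p - q \<in> P" if "p \<in> P" "q \<in> P" for p q using add[OF that(1) neg[OF that(2)]] by simp
  show pr: "p \<in> P \<or> q \<in> P" if "p \<in> carrier (LSS_ring n d)" "q \<in> carrier (LSS_ring n d)" "p * q \<in> P" for p q
    using I_prime[OF that(1,2)] that(3) by simp
  show "sum f F \<in> P" if "\<And>x. x \<in> F \<Longrightarrow> f x \<in> P" for F :: "'i set" and f
    using that by (induction F rule: infinite_finite_induct) (auto intro: z add)
  show "p \<in> P" if "p \<in> carrier (LSS_ring n d)" "p ^ k \<in> P" for p k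
    using that(2)
  proof (induction k)
    case 0
    then show ?case using one by simp
  next
    case (Suc k)
    have "p ^ k \<in> carrier (LSS_ring n d)"
      using that(1) by (simp add: carrier_LSS_ring polys_in_power)
    then show ?case using pr[OF that(1), of "p ^ k"] Suc by auto
  qed
qed

text \<open>A polynomial relation in the chosen elements \<open>g\<close> lies in the smallest prime \<open>Q 0\<close>.  Divide by the
  highest power of \<open>g 0\<close> dividing all of its terms, which is possible because \<open>g 0 \<notin> Q 0\<close>; the terms that still contain
  \<open>g 0\<close> lie in \<open>Q 1\<close>, hence so does the sum of the others, which is a relation in one element less.
  Terms that survive have the same exponent at \<open>g 0\<close>, so they remain distinguished by their other
  exponents.\<close>

lemma prime_chain_peel:
  fixes Q :: "nat \<Rightarrow> 'k::field mpoly set" and y :: "'u \<Rightarrow> 'k mpoly"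
    and a :: "('u + nat \<Rightarrow> nat) \<Rightarrow> 'k"
  assumes Q: "\<And>i. i \<le> m \<Longrightarrow> primeideal (Q i) (LSS_ring n d)"
    and g: "\<And>i. i < m \<Longrightarrow> Q i \<subseteq> Q (Suc i) \<and> g i \<in> Q (Suc i) - Q i"
    and y: "\<And>u. u \<in> U \<Longrightarrow> y u \<in> carrier (LSS_ring n d)"
    and B: "finite B" "B \<noteq> {}" "B \<subseteq> extensional (Inl ` U \<union> Inr ` {..<m})"
    and rel: "(\<Sum>\<gamma>\<in>B. const (a \<gamma>) * (\<Prod>u\<in>U. y u ^ \<gamma> (Inl u)) * (\<Prod>j<m. g j ^ \<gamma> (Inr j))) \<in> Q 0"
  obtains C where "C \<subseteq> B" "C \<noteq> {}" "inj_on (\<lambda>\<gamma>. restrict (\<gamma> \<circ> Inl) U) C"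
    "(\<Sum>\<gamma>\<in>C. const (a \<gamma>) * (\<Prod>u\<in>U. y u ^ \<gamma> (Inl u))) \<in> Q m"
proof -
  let ?R = "LSS_ring n d :: 'k mpoly ring"
  define T where "T k \<gamma> = const (a \<gamma>) * (\<Prod>u\<in>U. y u ^ \<gamma> (Inl u)) * (\<Prod>j\<in>{k..<m}. g j ^ \<gamma> (Inr j))"
    for k \<gamma>
  have gR: "g i \<in> carrier ?R" if "i < m" for i
    using g[OF that] primeideal_LSS_ringD(2)[OF Q[of "Suc i"]] that by auto
  have TR: "T k \<gamma> \<in> carrier ?R" for k \<gamma>
    unfolding T_def using y gR unfolding carrier_LSS_ring
    by (intro polys_in_times polys_in_prod polys_in_power polys_in_const) auto
  define inj where "inj k C \<longleftrightarrow> (\<forall>\<gamma>\<in>C. \<forall>\<delta>\<in>C. (\<forall>u\<in>U. \<gamma> (Inl u) = \<delta> (Inl u)) \<and>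
      (\<forall>j\<in>{k..<m}. \<gamma> (Inr j) = \<delta> (Inr j)) \<longrightarrow> \<gamma> = \<delta>)" for k and C :: "('u + nat \<Rightarrow> nat) set"
  have "\<exists>C \<subseteq> B. C \<noteq> {} \<and> inj k C \<and> (\<Sum>\<gamma>\<in>C. T k \<gamma>) \<in> Q k" if "k \<le> m" for k
    using that
  proof (induction k)
    case 0
    have "inj 0 B" unfolding inj_def
    proof (intro ballI impI)
      fix \<gamma> \<delta> assume "\<gamma> \<in> B" "\<delta> \<in> B" and eq: "(\<forall>u\<in>U. \<gamma> (Inl u) = \<delta> (Inl u)) \<and>
        (\<forall>j\<in>{0..<m}. \<gamma> (Inr j) = \<delta> (Inr j))"
      then show "\<gamma> = \<delta>" using B(3)
        by (intro extensionalityI[of \<gamma> "Inl ` U \<union> Inr ` {..<m}" \<delta>]) auto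
    qed
    then show ?case using B rel
      by (intro exI[of _ B]) (simp add: T_def atLeast0LessThan)
  next
    case (Suc k)
    then obtain C where C: "C \<subseteq> B" "C \<noteq> {}" "inj k C" "(\<Sum>\<gamma>\<in>C. T k \<gamma>) \<in> Q k" by auto
    have km: "k < m" using Suc.prems by simp
    have Qk: "primeideal (Q k) ?R" and QS: "primeideal (Q (Suc k)) ?R" using Q km by simp_all
    note prk = primeideal_LSS_ringD[OF Qk] and prS = primeideal_LSS_ringD[OF QS]
    have fC: "finite C" using C(1) B(1) finite_subset by blast
    define e where "e = Min ((\<lambda>\<gamma>. \<gamma> (Inr k)) ` C)"
    have e_le: "e \<le> \<gamma> (Inr k)" if "\<gamma> \<in> C" for \<gamma> using that fC by (simp add: e_def)
    define C' where "C' = {\<gamma>\<in>C. \<gamma> (Inr k) = e}"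
    have "e \<in> (\<lambda>\<gamma>. \<gamma> (Inr k)) ` C" unfolding e_def using fC C(2) by (intro Min_in) auto
    then have C'ne: "C' \<noteq> {}" by (auto simp: C'_def)
    have Tk: "T k \<gamma> = g k ^ e * (g k ^ (\<gamma> (Inr k) - e) * T (Suc k) \<gamma>)" if "\<gamma> \<in> C" for \<gamma>
    proof -
      have "(\<Prod>j\<in>{k..<m}. g j ^ \<gamma> (Inr j)) = g k ^ \<gamma> (Inr k) * (\<Prod>j\<in>{Suc k..<m}. g j ^ \<gamma> (Inr j))"
        using km by (rule prod.atLeast_Suc_lessThan)
      moreover have "g k ^ \<gamma> (Inr k) = g k ^ e * g k ^ (\<gamma> (Inr k) - e)"
        using e_le[OF that] by (simp flip: power_add)
      ultimately show ?thesis by (simp add: T_def mult_ac)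
    qed
    define S where "S = (\<Sum>\<gamma>\<in>C. g k ^ (\<gamma> (Inr k) - e) * T (Suc k) \<gamma>)"
    have SR: "S \<in> carrier ?R" and gek: "g k ^ e \<in> carrier ?R" unfolding S_def using gR[OF km] TR
      unfolding carrier_LSS_ring by (auto intro!: polys_in_sum polys_in_times polys_in_power)
    have "g k ^ e * S \<in> Q k" using C(4) by (simp add: S_def sum_distrib_left Tk)
    then have "S \<in> Q k" using prk(9)[OF gek SR] prk(11)[OF gR[OF km]] g[OF km] km by auto
    then have "S \<in> Q (Suc k)" using g[OF km] by blast
    moreover have "S = (\<Sum>\<gamma>\<in>C'. T (Suc k) \<gamma>) + (\<Sum>\<gamma>\<in>C - C'. g k ^ (\<gamma> (Inr k) - e) * T (Suc k) \<gamma>)"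
      unfolding S_def using fC by (subst sum.subset_diff[of C' C]) (auto simp: C'_def add.commute)
    moreover have "(\<Sum>\<gamma>\<in>C - C'. g k ^ (\<gamma> (Inr k) - e) * T (Suc k) \<gamma>) \<in> Q (Suc k)"
    proof (rule prS(10))
      fix \<gamma> assume "\<gamma> \<in> C - C'"
      then obtain r where r: "\<gamma> (Inr k) - e = Suc r"
        using e_le[of \<gamma>] by (cases "\<gamma> (Inr k) - e") (auto simp: C'_def)
      have "g k ^ r * T (Suc k) \<gamma> \<in> carrier ?R" using gR[OF km] TR unfolding carrier_LSS_ring
        by (auto intro!: polys_in_times polys_in_power)
      then show "g k ^ (\<gamma> (Inr k) - e) * T (Suc k) \<gamma> \<in> Q (Suc k)"
        using prS(7)[of "g k"] g[OF km] km by (simp add: r mult.assoc)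
    qed
    ultimately have "(\<Sum>\<gamma>\<in>C'. T (Suc k) \<gamma>) \<in> Q (Suc k)"
      using prS(6)[of S "\<Sum>\<gamma>\<in>C - C'. g k ^ (\<gamma> (Inr k) - e) * T (Suc k) \<gamma>"] by simp
    moreover have "inj (Suc k) C'" unfolding inj_def
    proof (intro ballI impI)
      fix \<gamma> \<delta> assume gd: "\<gamma> \<in> C'" "\<delta> \<in> C'" and eq: "(\<forall>u\<in>U. \<gamma> (Inl u) = \<delta> (Inl u)) \<and>
        (\<forall>j\<in>{Suc k..<m}. \<gamma> (Inr j) = \<delta> (Inr j))"
      have "\<gamma> (Inr j) = \<delta> (Inr j)" if "j \<in> {k..<m}" for j
        using that eq gd by (cases "j = k") (auto simp: C'_def)
      then show "\<gamma> = \<delta>" using C(3) gd eq unfolding inj_def C'_def by blast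
    qed
    ultimately show ?case using C'ne C(1) by (intro exI[of _ C']) (auto simp: C'_def)
  qed
  then obtain C where C: "C \<subseteq> B" "C \<noteq> {}" "inj m C" "(\<Sum>\<gamma>\<in>C. T m \<gamma>) \<in> Q m" by blast
  have "inj_on (\<lambda>\<gamma>. restrict (\<gamma> \<circ> Inl) U) C"
  proof (rule inj_onI)
    fix \<gamma> \<delta> assume "\<gamma> \<in> C" "\<delta> \<in> C" and eq: "restrict (\<gamma> \<circ> Inl) U = restrict (\<delta> \<circ> Inl) U"
    moreover have "\<gamma> (Inl u) = \<delta> (Inl u)" if "u \<in> U" for u using fun_cong[OF eq, of u] that by simp
    ultimately show "\<gamma> = \<delta>" using C(3) by (simp add: inj_def)
  qed
  then show thesis using that[of C] C by (simp add: T_def)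
qed

definition monomial_on :: "'v set \<Rightarrow> ('v \<Rightarrow> nat) \<Rightarrow> 'v \<Rightarrow>\<^sub>0 nat" where
  "monomial_on U \<alpha> = (\<Sum>u\<in>U. Poly_Mapping.single u (\<alpha> u))"

lemma lookup_monomial_on: "finite U \<Longrightarrow> Poly_Mapping.lookup (monomial_on U \<alpha>) x = (if x \<in> U then \<alpha> x else 0)"
  by (simp add: monomial_on_def lookup_sum lookup_single when_def)

lemma prod_var_powers:
  "(\<Prod>u\<in>U. Poly_Mapping.single (Poly_Mapping.single u 1) 1 ^ \<alpha> u)
     = Poly_Mapping.single (monomial_on U \<alpha>) (1::'k::comm_ring_1)"
proof -
  have pw: "Poly_Mapping.single (Poly_Mapping.single u 1) (1::'k) ^ k
      = Poly_Mapping.single (Poly_Mapping.single u k) 1" for u :: 'v and k :: nat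
    by (induction k) (simp_all add: mult_single single_add[symmetric])
  show ?thesis unfolding monomial_on_def pw
    by (induction U rule: infinite_finite_induct) (simp_all add: mult_single)
qed

text \<open>A longer chain would provide more than \<open>n d\<close> elements (the variables in \<open>U\<close> and one new element
  for each step), so they would be algebraically dependent, and peeling the relation would leave a nonzero
  polynomial in the variables \<open>U\<close> inside the largest prime.\<close>

theorem prime_chain_length_le:
  fixes Q :: "nat \<Rightarrow> 'k::field mpoly set"
  assumes Q: "\<And>i. i \<le> m \<Longrightarrow> primeideal (Q i) (LSS_ring n d)"
    and strict: "\<And>i. i < m \<Longrightarrow> Q i \<subset> Q (Suc i)"
    and U: "U \<subseteq> {1..n} \<times> {1..d}" "Q m \<inter> polys_in U \<subseteq> {0}"
  shows "m + card U \<le> n * d"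
proof (rule ccontr)
  assume "\<not> m + card U \<le> n * d"
  then have gt: "n * d < m + card U" by simp
  have fU: "finite U" using U(1) finite_subset by blast
  have "\<forall>i. \<exists>p. i < m \<longrightarrow> p \<in> Q (Suc i) - Q i" using strict by blast
  then obtain g where g: "\<And>i. i < m \<Longrightarrow> g i \<in> Q (Suc i) - Q i" by metis
  define y where "y u = (Poly_Mapping.single (Poly_Mapping.single u 1) 1 :: 'k mpoly)" for u :: "nat \<times> nat"
  have y: "y u \<in> carrier (LSS_ring n d)" if "u \<in> U" for u
    using that U(1) by (auto simp: y_def carrier_LSS_ring polys_in_def)
  define J where "J = (Inl ` U \<union> Inr ` {..<m} :: (nat \<times> nat + nat) set)"
  have J: "finite J" "card J = card U + m"
    unfolding J_def using fU card_Plus[of U "{..<m}"] by (simp_all add: Plus_def)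
  define h where "h = case_sum y g"
  have h: "h i \<in> polys_in ({1..n} \<times> {1..d})" if "i \<in> J" for i
  proof -
    have "g j \<in> carrier (LSS_ring n d)" if "j < m" for j
      using g[OF that] primeideal_LSS_ringD(2)[OF Q[of "Suc j"]] that by auto
    then show ?thesis
      using that y unfolding J_def h_def carrier_LSS_ring[symmetric] by auto
  qed
  obtain B a where B: "finite B" "B \<noteq> {}" "B \<subseteq> extensional J" "\<And>\<gamma>. \<gamma> \<in> B \<Longrightarrow> a \<gamma> \<noteq> 0"
    "(\<Sum>\<gamma>\<in>B. const (a \<gamma>) * (\<Prod>i\<in>J. h i ^ \<gamma> i)) = 0"
    using algebraic_dependence[OF J(1), of "{1..n} \<times> {1..d}" h] h J(2) gt by auto
  have split: "(\<Prod>i\<in>J. h i ^ \<gamma> i) = (\<Prod>u\<in>U. y u ^ \<gamma> (Inl u)) * (\<Prod>j<m. g j ^ \<gamma> (Inr j))" for \<gamma>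
    unfolding J_def using fU
    by (subst prod.union_disjoint) (auto simp: prod.reindex inj_on_def h_def)
  have rel: "(\<Sum>\<gamma>\<in>B. const (a \<gamma>) * (\<Prod>u\<in>U. y u ^ \<gamma> (Inl u)) * (\<Prod>j<m. g j ^ \<gamma> (Inr j))) \<in> Q 0"
    using B(5) primeideal_LSS_ringD(1)[OF Q[of 0]] by (simp add: split mult.assoc)
  have gQ: "Q i \<subseteq> Q (Suc i) \<and> g i \<in> Q (Suc i) - Q i" if "i < m" for i
    using strict[OF that] g[OF that] by blast
  obtain C where C: "C \<subseteq> B" "C \<noteq> {}" "inj_on (\<lambda>\<gamma>. restrict (\<gamma> \<circ> Inl) U) C"
    "(\<Sum>\<gamma>\<in>C. const (a \<gamma>) * (\<Prod>u\<in>U. y u ^ \<gamma> (Inl u))) \<in> Q m"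
    by (rule prime_chain_peel[OF Q gQ y B(1,2) B(3)[unfolded J_def] rel],
        assumption, assumption, assumption, rule that)
  define s where "s = (\<Sum>\<gamma>\<in>C. const (a \<gamma>) * (\<Prod>u\<in>U. y u ^ \<gamma> (Inl u)))"
  have fC: "finite C" using C(1) B(1) finite_subset by blast
  have s: "s = (\<Sum>\<gamma>\<in>C. Poly_Mapping.single (monomial_on U (\<gamma> \<circ> Inl)) (a \<gamma>))"
    unfolding s_def y_def using prod_var_powers[where ?'k = 'k and U = U]
    by (intro sum.cong) (simp_all add: mult_single comp_def)
  have "s \<in> polys_in U" unfolding s
    by (intro polys_in_sum) (auto simp: polys_in_def in_keys_iff lookup_monomial_on fU split: if_splits)
  then have "s = 0" using U(2) C(4) by (auto simp: s_def)
  moreover obtain \<delta> where \<delta>: "\<delta> \<in> C" using C(2) by blast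
  have "Poly_Mapping.lookup s (monomial_on U (\<delta> \<circ> Inl)) = (\<Sum>\<gamma>\<in>C. if \<gamma> = \<delta> then a \<gamma> else 0)"
    unfolding s lookup_sum
  proof (rule sum.cong)
    fix \<gamma> assume \<gamma>: "\<gamma> \<in> C"
    have "monomial_on U (\<gamma> \<circ> Inl) = monomial_on U (\<delta> \<circ> Inl) \<Longrightarrow> \<gamma> = \<delta>"
    proof -
      assume eq: "monomial_on U (\<gamma> \<circ> Inl) = monomial_on U (\<delta> \<circ> Inl)"
      have "(\<gamma> \<circ> Inl) u = (\<delta> \<circ> Inl) u" if "u \<in> U" for u
        using arg_cong[OF eq, of "\<lambda>m. Poly_Mapping.lookup m u"] that by (simp add: lookup_monomial_on fU)
      then have "restrict (\<gamma> \<circ> Inl) U = restrict (\<delta> \<circ> Inl) U" by (auto simp: restrict_def)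
      then show ?thesis using inj_onD[OF C(3) _ \<gamma> \<delta>] by blast
    qed
    then show "Poly_Mapping.lookup (Poly_Mapping.single (monomial_on U (\<gamma> \<circ> Inl)) (a \<gamma>)) (monomial_on U (\<delta> \<circ> Inl))
        = (if \<gamma> = \<delta> then a \<gamma> else 0)"
      by (auto simp: lookup_single when_def)
  qed simp
  then have "Poly_Mapping.lookup s (monomial_on U (\<delta> \<circ> Inl)) \<noteq> 0" using \<delta> fC C(1) B(4) by auto
  ultimately show False by simp
qed

corollary prime_height_le:
  fixes P :: "'k::field mpoly set"
  assumes "U \<subseteq> {1..n} \<times> {1..d}" "P \<inter> polys_in U \<subseteq> {0}" "n * d \<le> k + card U"
  shows "prime_height (LSS_ring n d) P \<le> enat k"
  unfolding prime_height_def
proof (rule Sup_least, clarsimp)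
  fix m and Q :: "nat \<Rightarrow> 'k mpoly set"
  assume "\<forall>i\<le>m. primeideal (Q i) (LSS_ring n d)" "\<forall>i<m. Q i \<subset> Q (Suc i)" "P = Q m"
  then have "m + card U \<le> n * d" using assms by (intro prime_chain_length_le) auto
  then show "m \<le> k" using assms(3) by simp
qed


section \<open>Evaluation homomorphisms\<close>

definition mono_eval :: "('v \<Rightarrow> 'r::comm_ring_1) \<Rightarrow> ('v \<Rightarrow>\<^sub>0 nat) \<Rightarrow> 'r" where
  "mono_eval \<psi> m = (\<Prod>x\<in>Poly_Mapping.keys m. \<psi> x ^ Poly_Mapping.lookup m x)"

lemma mono_eval_superset:
  assumes "finite F" "Poly_Mapping.keys m \<subseteq> F"
  shows "mono_eval \<psi> m = (\<Prod>x\<in>F. \<psi> x ^ Poly_Mapping.lookup m x)"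
  unfolding mono_eval_def using assms
  by (intro prod.mono_neutral_left) (auto simp: in_keys_iff)

lemma mono_eval_add: "mono_eval \<psi> (m + m') = mono_eval \<psi> m * mono_eval \<psi> m'"
proof -
  define F where "F = Poly_Mapping.keys m \<union> Poly_Mapping.keys m'"
  have F: "finite F" "Poly_Mapping.keys m \<subseteq> F" "Poly_Mapping.keys m' \<subseteq> F"
    "Poly_Mapping.keys (m + m') \<subseteq> F"
    using keys_add[of m m'] by (auto simp: F_def)
  show ?thesis
    unfolding F(2,3,4)[THEN mono_eval_superset[OF F(1)]]
    by (simp add: lookup_add power_add prod.distrib)
qed

lemma mono_eval_zero [simp]: "mono_eval \<psi> 0 = 1"
  by (simp add: mono_eval_def)

lemma mono_eval_single [simp]: "mono_eval \<psi> (Poly_Mapping.single x k) = \<psi> x ^ k"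
  by (cases "k = 0") (simp_all add: mono_eval_def)

locale coefficient_hom =
  fixes \<iota> :: "'k::comm_ring_1 \<Rightarrow> 'r::comm_ring_1"
  assumes hom_add: "\<iota> (a + b) = \<iota> a + \<iota> b" and hom_mult: "\<iota> (a * b) = \<iota> a * \<iota> b"
    and hom_one: "\<iota> 1 = 1"
begin

lemma hom_zero: "\<iota> 0 = 0"
  using hom_add[of 0 0] by simp

definition poly_eval :: "('v \<Rightarrow> 'r) \<Rightarrow> (('v \<Rightarrow>\<^sub>0 nat) \<Rightarrow>\<^sub>0 'k) \<Rightarrow> 'r" where
  "poly_eval \<psi> p = (\<Sum>m\<in>Poly_Mapping.keys p. \<iota> (Poly_Mapping.lookup p m) * mono_eval \<psi> m)"

lemma poly_eval_superset:
  assumes "finite F" "Poly_Mapping.keys p \<subseteq> F"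
  shows "poly_eval \<psi> p = (\<Sum>m\<in>F. \<iota> (Poly_Mapping.lookup p m) * mono_eval \<psi> m)"
  unfolding poly_eval_def using assms
  by (intro sum.mono_neutral_left) (auto simp: in_keys_iff hom_zero)

lemma poly_eval_add: "poly_eval \<psi> (p + q) = poly_eval \<psi> p + poly_eval \<psi> q"
proof -
  define F where "F = Poly_Mapping.keys p \<union> Poly_Mapping.keys q"
  have F: "finite F" "Poly_Mapping.keys p \<subseteq> F" "Poly_Mapping.keys q \<subseteq> F"
    "Poly_Mapping.keys (p + q) \<subseteq> F"
    using keys_add[of p q] by (auto simp: F_def)
  show ?thesis
    unfolding F(2,3,4)[THEN poly_eval_superset[OF F(1)]]
    by (simp add: lookup_add hom_add distrib_right sum.distrib)
qed

lemma poly_eval_zero [simp]: "poly_eval \<psi> 0 = 0"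
  by (simp add: poly_eval_def)

lemma poly_eval_single: "poly_eval \<psi> (Poly_Mapping.single m c) = \<iota> c * mono_eval \<psi> m"
  by (cases "c = 0") (simp_all add: poly_eval_def hom_zero)

lemma poly_eval_mult: "poly_eval \<psi> (p * q) = poly_eval \<psi> p * poly_eval \<psi> q"
proof (induction p rule: poly_induct)
  case (single m c)
  show ?case
  proof (induction q rule: poly_induct)
    case (single m' c')
    then show ?case by (simp add: mult_single poly_eval_single hom_mult mono_eval_add mult_ac)
  qed (simp_all add: distrib_left poly_eval_add)
qed (simp_all add: distrib_right poly_eval_add)

lemma poly_eval_one [simp]: "poly_eval \<psi> 1 = 1"
  using poly_eval_single[of \<psi> 0 1] by (simp add: hom_one)

lemma poly_eval_sum: "poly_eval \<psi> (sum f F) = (\<Sum>x\<in>F. poly_eval \<psi> (f x))"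
  by (induction F rule: infinite_finite_induct) (simp_all add: poly_eval_add)

end


section \<open>Primes of small height over an LSS ideal\<close>

lemma LSS_ring_idealI:
  fixes P :: "'k::field mpoly set"
  assumes "P \<subseteq> carrier (LSS_ring n d)" "0 \<in> P" "\<And>p q. p \<in> P \<Longrightarrow> q \<in> P \<Longrightarrow> p + q \<in> P"
    "\<And>p q. p \<in> P \<Longrightarrow> q \<in> carrier (LSS_ring n d) \<Longrightarrow> q * p \<in> P"
  shows "ideal P (LSS_ring n d)"
proof -
  interpret cring "LSS_ring n d :: 'k mpoly ring" by (rule LSS_ring_cring)
  have neg: "- p \<in> P" if "p \<in> P" for p
    using assms(4)[OF that, of "- 1"] by (simp add: carrier_LSS_ring polys_in_uminus)
  have "subgroup P (add_monoid (LSS_ring n d))"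
  proof (rule add.subgroupI)
    fix p assume p: "p \<in> P"
    have "\<ominus>\<^bsub>LSS_ring n d\<^esub> p = - p"
      using p neg[OF p] assms(1) by (intro minus_equality) auto
    then show "\<ominus>\<^bsub>LSS_ring n d\<^esub> p \<in> P" using neg[OF p] by simp
  qed (use assms in auto)
  moreover have "p * q \<in> P" if "p \<in> P" "q \<in> carrier (LSS_ring n d)" for p q
    using assms(4)[OF that] by (simp add: mult.commute)
  ultimately show ?thesis
    by (intro idealI[OF ring_axioms]) (simp_all add: assms(4))
qed

lemma LSS_ring_primeidealI:
  fixes P :: "'k::field mpoly set"
  assumes "ideal P (LSS_ring n d)" "1 \<notin> P"
    "\<And>p q. p \<in> carrier (LSS_ring n d) \<Longrightarrow> q \<in> carrier (LSS_ring n d) \<Longrightarrow> p * q \<in> P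
       \<Longrightarrow> p \<in> P \<or> q \<in> P"
  shows "primeideal P (LSS_ring n d)"
proof (rule primeidealI[OF assms(1) LSS_ring_cring])
  have "(1 :: 'k mpoly) \<in> carrier (LSS_ring n d)" by (simp add: carrier_LSS_ring)
  then show "carrier (LSS_ring n d) \<noteq> P" using assms(2) by auto
qed (use assms(3) in auto)

lemma to_fract_power: "to_fract (x ^ k) = to_fract x ^ k"
  by (induction k) simp_all

lemma to_fract_prod: "to_fract (prod f F) = (\<Prod>x\<in>F. to_fract (f x))"
  by (induction F rule: infinite_finite_induct) simp_all

lemma monomial_on_keys: "monomial_on (Poly_Mapping.keys m) (Poly_Mapping.lookup m) = m"
  by (rule poly_mapping_eqI) (auto simp: lookup_monomial_on in_keys_iff)

text \<open>Vertices are treated in increasing order.  The vector of a vertex outside \<open>Z\<close> solves one linear equation for each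
  smaller neighbour outside \<open>Z\<close>, and the coordinates in \<open>L v\<close> are the free unknowns of that system.  Vertices in \<open>Z\<close> get the zero vector, which
  makes the equations of their neighbours trivial.\<close>

lemma orthogonal_vectors_free_coordinates:
  fixes t :: "nat \<Rightarrow> nat \<Rightarrow> 'k::field"
  obtains x L where "\<And>v. L v \<subseteq> {1..d}" "\<And>v l. l \<in> L v \<Longrightarrow> x v l = t v l"
    "\<And>u v. 1 \<le> u \<Longrightarrow> u < v \<Longrightarrow> v \<le> n \<Longrightarrow> {u, v} \<in> E \<Longrightarrow> (\<Sum>l=1..d. x u l * x v l) = 0"
    "\<And>v. v \<in> {1..n} \<Longrightarrow> v \<notin> Z \<Longrightarrow>
       d \<le> card (L v) + card {u \<in> {1..<v}. u \<notin> Z \<and> {u, v} \<in> E}"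
proof -
  have "\<exists>x L. (\<forall>v. L v \<subseteq> {1..d}) \<and> (\<forall>v. \<forall>l \<in> L v. x v l = t v l)
     \<and> (\<forall>u v. 1 \<le> u \<and> u < v \<and> v \<le> n \<and> {u, v} \<in> E \<longrightarrow> (\<Sum>l=1..d. x u l * x v l) = 0)
     \<and> (\<forall>v \<in> {1..n} \<inter> Z. \<forall>l. x v l = 0)
     \<and> (\<forall>v \<in> {1..n} - Z. d \<le> card (L v) + card {u \<in> {1..<v}. u \<notin> Z \<and> {u, v} \<in> E})"
  proof (induction n)
    case 0
    show ?case by (intro exI[of _ t] exI[of _ "\<lambda>_. {}"]) auto
  next
    case (Suc n)
    from Suc obtain x L where xL: "\<forall>v. L v \<subseteq> {1..d}" "\<forall>v. \<forall>l \<in> L v. x v l = t v l"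
      "\<forall>u v. 1 \<le> u \<and> u < v \<and> v \<le> n \<and> {u, v} \<in> E \<longrightarrow> (\<Sum>l=1..d. x u l * x v l) = 0"
      "\<forall>v \<in> {1..n} \<inter> Z. \<forall>l. x v l = 0"
      "\<forall>v \<in> {1..n} - Z. d \<le> card (L v) + card {u \<in> {1..<v}. u \<notin> Z \<and> {u, v} \<in> E}"
      by (elim exE conjE) (rule that)
    define Y where "Y = {u \<in> {1..<Suc n}. u \<notin> Z \<and> {u, Suc n} \<in> E}"
    obtain L0 s where s: "L0 \<subseteq> {1..d}" "\<forall>l\<in>L0. s l = t (Suc n) l"
      "\<forall>u\<in>Y. (\<Sum>l=1..d. x u l * s l) = 0" "Suc n \<notin> Z \<Longrightarrow> d \<le> card L0 + card Y"
      "Suc n \<in> Z \<Longrightarrow> \<forall>l. s l = 0"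
    proof (cases "Suc n \<in> Z")
      case True
      then show ?thesis using that[of "{}" "\<lambda>_. 0"] by simp
    next
      case False
      have fin: "finite {1..d}" "finite Y" by (simp_all add: Y_def)
      obtain L0 where L0: "L0 \<subseteq> {1..d}" "card {1..d} \<le> card L0 + card Y"
        "\<And>t. \<exists>s. (\<forall>l\<in>L0. s l = t l) \<and> (\<forall>u\<in>Y. (\<Sum>l\<in>{1..d}. x u l * s l) = 0)"
        by (rule linear_system_free_unknowns[OF fin, of x]) (rule that)
      from L0(3)[of "t (Suc n)"] obtain s where
        s: "\<forall>l\<in>L0. s l = t (Suc n) l" "\<forall>u\<in>Y. (\<Sum>l\<in>{1..d}. x u l * s l) = 0" by blast
      show ?thesis
      proof (rule that[OF L0(1) s])
        show "d \<le> card L0 + card Y" using L0(2) by simp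
      qed (use False in simp)
    qed
    show ?case
    proof (intro exI[of _ "x(Suc n := s)"] exI[of _ "L(Suc n := L0)"] conjI allI ballI impI)
      fix u v assume uv: "1 \<le> u \<and> u < v \<and> v \<le> Suc n \<and> {u, v} \<in> E"
      show "(\<Sum>l=1..d. (x(Suc n := s)) u l * (x(Suc n := s)) v l) = 0"
      proof (cases "v = Suc n")
        case True
        then show ?thesis using uv s(3) xL(4) by (cases "u \<in> Z") (auto simp: Y_def)
      next
        case False
        then show ?thesis using uv xL(3) by simp
      qed
    next
      fix v assume v: "v \<in> {1..Suc n} - Z"
      show "d \<le> card ((L(Suc n := L0)) v) + card {u \<in> {1..<v}. u \<notin> Z \<and> {u, v} \<in> E}"
        using v s(4) xL(5) by (cases "v = Suc n") (auto simp: Y_def)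
    qed (use xL s in \<open>auto split: if_splits\<close>)
  qed
  then obtain x L where "(\<forall>v. L v \<subseteq> {1..d}) \<and> (\<forall>v. \<forall>l \<in> L v. x v l = t v l)
     \<and> (\<forall>u v. 1 \<le> u \<and> u < v \<and> v \<le> n \<and> {u, v} \<in> E \<longrightarrow> (\<Sum>l=1..d. x u l * x v l) = 0)
     \<and> (\<forall>v \<in> {1..n} \<inter> Z. \<forall>l. x v l = 0)
     \<and> (\<forall>v \<in> {1..n} - Z. d \<le> card (L v) + card {u \<in> {1..<v}. u \<notin> Z \<and> {u, v} \<in> E})" by blast
  then show thesis by (intro that[of L x]) auto
qed

text \<open>Each edge that avoids \<open>Z\<close> is counted at most once, namely at its larger end.\<close>

lemma card_pairs_le_edges:
  fixes E :: "nat set set"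
  assumes "finite E"
  shows "(\<Sum>v\<in>{1..n} - Z. card {u \<in> {1..<v}. u \<notin> Z \<and> {u, v} \<in> E}) \<le> card {e \<in> E. e \<inter> Z = {}}"
proof -
  let ?S = "Sigma ({1..n} - Z) (\<lambda>v. {u \<in> {1..<v}. u \<notin> Z \<and> {u, v} \<in> E})"
  have "inj_on (\<lambda>(v, u). {u, v}) ?S" by (auto simp: inj_on_def doubleton_eq_iff)
  moreover have "(\<lambda>(v, u). {u, v}) ` ?S \<subseteq> {e \<in> E. e \<inter> Z = {}}" by auto
  ultimately have "card ?S \<le> card {e \<in> E. e \<inter> Z = {}}"
    using assms by (intro card_inj_on_le) auto
  then show ?thesis by simp
qed

text \<open>The variables are sent to the coordinates of generic vectors that are orthogonal along the edges.  The kernel contains the ideal, and it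
  contains no nonzero polynomial in the free coordinates because these are sent to themselves.  Taking \<open>Z\<close> empty
  gives the bound by the number of edges; a vertex \<open>v\<close> of degree greater than \<open>d\<close> makes \<open>Z = {v}\<close> strictly better.\<close>

theorem ideal_height_LSS_ideal_le:
  assumes G: "simple_graph {1..n} E" and Z: "Z \<subseteq> {1..n}"
  shows "ideal_height (LSS_ring n d) (LSS_ideal n E d :: 'k::field mpoly set)
           \<le> enat (d * card Z + card {e \<in> E. e \<inter> Z = {}})"
proof -
  let ?R = "LSS_ring n d :: 'k mpoly ring"
  have fE: "finite E" using G finite_subset[of E "Pow {1..n}"] by (auto simp: simple_graph_def)
  interpret coefficient_hom "\<lambda>c :: 'k. to_fract (const c :: 'k mpoly)"
    by unfold_locales (simp_all add: single_add mult_single flip: to_fract_mult)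
  define t where "t v l = to_fract (var v l :: 'k mpoly)" for v l
  obtain x L where L: "\<And>v. L v \<subseteq> {1..d}" and xt: "\<And>v l. l \<in> L v \<Longrightarrow> x v l = t v l"
    and orth: "\<And>u v. 1 \<le> u \<Longrightarrow> u < v \<Longrightarrow> v \<le> n \<Longrightarrow> {u, v} \<in> E \<Longrightarrow> (\<Sum>l=1..d. x u l * x v l) = 0"
    and cL: "\<And>v. v \<in> {1..n} \<Longrightarrow> v \<notin> Z \<Longrightarrow>
       d \<le> card (L v) + card {u \<in> {1..<v}. u \<notin> Z \<and> {u, v} \<in> E}"
    by (rule orthogonal_vectors_free_coordinates[of d t n E Z]) (rule that)
  define \<psi> where "\<psi> = (\<lambda>(v, l). x v l)"
  define P where "P = {p \<in> carrier ?R. poly_eval \<psi> p = 0}"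
  define U where "U = Sigma {1..n} L"
  have id: "ideal P ?R"
    by (rule LSS_ring_idealI) (auto simp: P_def poly_eval_add poly_eval_mult carrier_LSS_ring
        intro: polys_in_add polys_in_times)
  have prime: "primeideal P ?R"
    by (rule LSS_ring_primeidealI[OF id]) (auto simp: P_def poly_eval_mult)
  have gen: "LSS_gen d i j \<in> P" if e: "{i, j} \<in> E" for i j
  proof -
    have "{i, j} \<subseteq> {1..n} \<and> card {i, j} = 2" using e G unfolding simple_graph_def by blast
    then have ij: "i \<in> {1..n}" "j \<in> {1..n}" "i \<noteq> j" by auto
    have "poly_eval \<psi> (LSS_gen d i j) = (\<Sum>l=1..d. x i l * x j l)"
      by (simp add: LSS_gen_def poly_eval_sum poly_eval_mult var_def poly_eval_single \<psi>_def)
    also have "\<dots> = 0"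
      using orth[of i j] orth[of j i] ij e
      by (cases "i < j") (auto simp: insert_commute mult.commute)
    finally show ?thesis using LSS_gen_in_carrier[OF ij(1,2)] by (simp add: P_def)
  qed
  have sub: "LSS_ideal n E d \<subseteq> P"
  proof -
    interpret cring ?R by (rule LSS_ring_cring)
    show ?thesis unfolding LSS_ideal_def using gen by (intro genideal_minimal[OF id]) auto
  qed
  have U: "U \<subseteq> {1..n} \<times> {1..d}" using L by (auto simp: U_def)
  have "P \<inter> polys_in U \<subseteq> {0}"
  proof
    fix p assume p: "p \<in> P \<inter> polys_in U"
    have me: "mono_eval \<psi> m = to_fract (Poly_Mapping.single m 1)" if "Poly_Mapping.keys m \<subseteq> U" for m
    proof -
      have "mono_eval \<psi> m = (\<Prod>u\<in>Poly_Mapping.keys m.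
          to_fract (Poly_Mapping.single (Poly_Mapping.single u 1) 1 ^ Poly_Mapping.lookup m u))"
        unfolding mono_eval_def
        by (rule prod.cong) (use that xt in \<open>auto simp: \<psi>_def t_def var_def U_def to_fract_power\<close>)
      also have "\<dots> = to_fract (Poly_Mapping.single m 1)"
        unfolding to_fract_prod[symmetric] prod_var_powers monomial_on_keys ..
      finally show ?thesis .
    qed
    have "poly_eval \<psi> p = to_fract p"
    proof -
      have "poly_eval \<psi> p = (\<Sum>m\<in>Poly_Mapping.keys p. to_fract (Poly_Mapping.single m (Poly_Mapping.lookup p m)))"
        unfolding poly_eval_def
      proof (rule sum.cong)
        fix m assume "m \<in> Poly_Mapping.keys p"
        then have "Poly_Mapping.keys m \<subseteq> U" using p by (auto simp: polys_in_def)
        from me[OF this]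
        show "to_fract (const (Poly_Mapping.lookup p m)) * mono_eval \<psi> m
            = to_fract (Poly_Mapping.single m (Poly_Mapping.lookup p m))"
          by (simp add: mult_single flip: to_fract_mult)
      qed simp
      also have "\<dots> = to_fract (\<Sum>m\<in>Poly_Mapping.keys p. Poly_Mapping.single m (Poly_Mapping.lookup p m))"
        by (simp add: to_fract_sum)
      also have "\<dots> = to_fract p" by (simp flip: poly_mapping_eq_sum_single)
      finally show ?thesis .
    qed
    then show "p \<in> {0}" using p by (simp add: P_def)
  qed
  moreover have "n * d \<le> (d * card Z + card {e \<in> E. e \<inter> Z = {}}) + card U"
  proof -
    let ?b = "\<lambda>v. card {u \<in> {1..<v}. u \<notin> Z \<and> {u, v} \<in> E}"
    have fZ: "finite Z" using Z finite_subset by blast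
    have "n * d = (\<Sum>v\<in>{1..n} - Z. d) + (\<Sum>v\<in>Z. d)"
      using sum.subset_diff[OF Z, of "\<lambda>_. d"] by simp
    also have "(\<Sum>v\<in>{1..n} - Z. d) \<le> (\<Sum>v\<in>{1..n} - Z. card (L v) + ?b v)"
      using cL by (intro sum_mono) auto
    also have "\<dots> = (\<Sum>v\<in>{1..n} - Z. card (L v)) + (\<Sum>v\<in>{1..n} - Z. ?b v)" by (rule sum.distrib)
    also have "(\<Sum>v\<in>{1..n} - Z. card (L v)) \<le> (\<Sum>v\<in>{1..n}. card (L v))" by (intro sum_mono2) auto
    also have "\<dots> = card U" unfolding U_def using L by (subst card_SigmaI) (auto intro: finite_subset)
    also have "(\<Sum>v\<in>{1..n} - Z. ?b v) \<le> card {e \<in> E. e \<inter> Z = {}}" by (rule card_pairs_le_edges[OF fE])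
    finally show ?thesis by (simp add: mult.commute)
  qed
  ultimately have "prime_height ?R P \<le> enat (d * card Z + card {e \<in> E. e \<inter> Z = {}})"
    by (intro prime_height_le[OF U]) auto
  moreover have "ideal_height ?R (LSS_ideal n E d) \<le> prime_height ?R P"
    unfolding ideal_height_def using prime sub by (intro Inf_lower) blast
  ultimately show ?thesis by (rule order_trans[rotated])
qed


section \<open>Regular sequences bound the height from below\<close>

text \<open>An ideal that is maximal among those containing \<open>J\<close> and avoiding the multiplicative set \<open>M\<close> is prime.\<close>

lemma (in cring) exists_primeideal_disjoint:
  assumes J: "ideal J R" and M: "M \<subseteq> carrier R" "\<one> \<in> M"
    "\<And>a b. a \<in> M \<Longrightarrow> b \<in> M \<Longrightarrow> a \<otimes> b \<in> M" and disj: "J \<inter> M = {}"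
  obtains P where "primeideal P R" "J \<subseteq> P" "P \<inter> M = {}"
proof -
  define S where "S = {I. ideal I R \<and> J \<subseteq> I \<and> I \<inter> M = {}}"
  have "\<exists>P\<in>S. \<forall>I\<in>S. P \<subseteq> I \<longrightarrow> I = P"
  proof (rule subset_Zorn)
    fix C assume C: "subset.chain S C"
    show "\<exists>U\<in>S. \<forall>I\<in>C. I \<subseteq> U"
    proof (cases "C = {}")
      case True
      then show ?thesis using J disj by (auto simp: S_def)
    next
      case False
      have "subset.chain {I. ideal I R} C"
        using C unfolding S_def subset.chain_def by blast
      from chain_Union_is_ideal[OF this] False have "ideal (\<Union>C) R" by simp
      moreover have "C \<subseteq> S" using C unfolding subset.chain_def by blast
      ultimately have "\<Union>C \<in> S" using False by (auto simp: S_def)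
      then show ?thesis by blast
    qed
  qed
  then obtain P where PS: "P \<in> S" and Pmax: "\<forall>I\<in>S. P \<subseteq> I \<longrightarrow> I = P" ..
  from PS have P: "ideal P R" "J \<subseteq> P" "P \<inter> M = {}" by (simp_all add: S_def)
  have max: "I = P" if "ideal I R" "P \<subseteq> I" "I \<inter> M = {}" for I
    using Pmax that P(2) by (simp add: S_def)
  interpret P: ideal P R by (rule P(1))
  have meets: "\<exists>p\<in>P. \<exists>r\<in>carrier R. p \<oplus> r \<otimes> a \<in> M" if a: "a \<in> carrier R" "a \<notin> P" for a
  proof -
    have id: "ideal (P <+> PIdl a) R" by (rule add_ideals[OF P(1) cgenideal_ideal[OF a(1)]])
    have zP: "\<zero> \<in> P" by (rule additive_subgroup.zero_closed[OF P.is_additive_subgroup])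
    have zI: "\<zero> \<in> PIdl a"
      by (rule additive_subgroup.zero_closed[OF ideal.axioms(1)[OF cgenideal_ideal[OF a(1)]]])
    have "\<zero> \<oplus> a \<in> P <+> PIdl a"
      unfolding set_add_def' using zP cgenideal_self[OF a(1)] by blast
    then have "a \<in> P <+> PIdl a" using a(1) by simp
    moreover have "P \<subseteq> P <+> PIdl a"
    proof
      fix p assume p: "p \<in> P"
      have "p \<oplus> \<zero> \<in> P <+> PIdl a" unfolding set_add_def' using p zI by blast
      then show "p \<in> P <+> PIdl a" using P.Icarr[OF p] by simp
    qed
    ultimately have "(P <+> PIdl a) \<inter> M \<noteq> {}" using max[OF id] a(2) by blast
    then show ?thesis unfolding set_add_def' cgenideal_def by blast
  qed
  have "primeideal P R"
  proof (rule primeidealI[OF P(1)])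
    show "cring R" by (rule is_cring)
    show "carrier R \<noteq> P" using P(3) M(1,2) by blast
    fix a b assume ab: "a \<in> carrier R" "b \<in> carrier R" "a \<otimes> b \<in> P"
    show "a \<in> P \<or> b \<in> P"
    proof (rule ccontr)
      assume "\<not> (a \<in> P \<or> b \<in> P)"
      then obtain p r q s where pr: "p \<in> P" "r \<in> carrier R" "p \<oplus> r \<otimes> a \<in> M"
        and qs: "q \<in> P" "s \<in> carrier R" "q \<oplus> s \<otimes> b \<in> M"
        using meets[of a] meets[of b] ab by blast
      have c: "p \<in> carrier R" "q \<in> carrier R" using pr qs P.a_subset by auto
      have "(p \<oplus> r \<otimes> a) \<otimes> (q \<oplus> s \<otimes> b)
          = p \<otimes> (q \<oplus> s \<otimes> b) \<oplus> ((r \<otimes> a) \<otimes> q \<oplus> (r \<otimes> s) \<otimes> (a \<otimes> b))"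
        using ab(1,2) pr(2) qs(2) c by algebra
      also have "\<dots> \<in> P"
        using ab(1,2) pr(2) qs(2) c
        by (intro P.a_closed P.I_r_closed[OF pr(1)] P.I_l_closed[OF qs(1)] P.I_l_closed[OF ab(3)]) simp_all
      finally show False using M(3)[OF pr(3) qs(3)] P(3) by blast
    qed
  qed
  then show thesis using that P by blast
qed

text \<open>Since \<open>f\<close> is a nonzerodivisor modulo \<open>J\<close>, the ideal \<open>J\<close> contains no product of a power of \<open>f\<close> and an element
  outside \<open>P\<close>.  A prime over \<open>J\<close> that avoids all these products is contained in \<open>P\<close> and misses \<open>f\<close>.\<close>

lemma (in cring) primeideal_strictly_below:
  assumes J: "ideal J R" and P: "primeideal P R" "J \<subseteq> P" and f: "f \<in> P"
    and reg: "\<And>s. s \<in> carrier R \<Longrightarrow> s \<otimes> f \<in> J \<Longrightarrow> s \<in> J"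
  obtains P' where "primeideal P' R" "J \<subseteq> P'" "P' \<subset> P"
proof -
  interpret P: primeideal P R by (rule P(1))
  have fR: "f \<in> carrier R" using f P.a_subset by blast
  define M where "M = {s \<otimes> f [^] k | s k. s \<in> carrier R - P \<and> (k :: nat) \<in> UNIV}"
  have one: "\<one> \<notin> P" using P.I_notcarr P.one_imp_carrier by blast
  have inM: "s \<in> M" if "s \<in> carrier R - P" for s
    unfolding M_def using that fR by (auto intro!: exI[of _ s] exI[of _ "0 :: nat"])
  obtain P' where P': "primeideal P' R" "J \<subseteq> P'" "P' \<inter> M = {}"
  proof (rule exists_primeideal_disjoint[OF J])
    show "M \<subseteq> carrier R" using fR by (auto simp: M_def)
    show "\<one> \<in> M" using inM one by simp
    show "J \<inter> M = {}"
    proof -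
      have "s \<in> J" if "s \<otimes> f [^] k \<in> J" "s \<in> carrier R" for s and k :: nat
        using that
      proof (induction k arbitrary: s)
        case 0
        then show ?case by simp
      next
        case (Suc k)
        have "(s \<otimes> f [^] k) \<otimes> f \<in> J" using Suc.prems fR by (simp add: m_assoc)
        then show ?case using reg[of "s \<otimes> f [^] k"] Suc.IH[of s] Suc.prems(2) fR by simp
      qed
      then show ?thesis using P(2) by (auto simp: M_def)
    qed
    fix a b assume "a \<in> M" "b \<in> M"
    then obtain s k t l where st: "s \<in> carrier R" "s \<notin> P" "t \<in> carrier R" "t \<notin> P"
      "a = s \<otimes> f [^] (k :: nat)" "b = t \<otimes> f [^] (l :: nat)" by (auto simp: M_def)
    have "a \<otimes> b = (s \<otimes> t) \<otimes> (f [^] k \<otimes> f [^] l)"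
      using st fR by (simp add: m_ac)
    also have "\<dots> = (s \<otimes> t) \<otimes> f [^] (k + l)" using fR by (simp add: nat_pow_mult)
    finally show "a \<otimes> b \<in> M" using st P.I_prime[of s t] unfolding M_def by blast
  qed (rule that)
  have "\<one> \<otimes> f [^] (1 :: nat) \<in> M" unfolding M_def using one by blast
  then have "f \<notin> P'" using P'(3) fR by auto
  moreover have "P' \<subseteq> P"
    using inM P'(3) ideal.Icarr[OF primeideal.axioms(1)[OF P'(1)]] by blast
  ultimately show thesis using that P'(1,2) f by blast
qed

text \<open>The chain is built downwards from \<open>P\<close>: the next prime contains all elements of the sequence before \<open>f r\<close>, so the step can be repeated
  with the shorter sequence.\<close>

theorem (in cring) prime_height_ge_regular_sequence:
  assumes f: "\<And>i. i < r \<Longrightarrow> f i \<in> carrier R"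
    and reg: "\<And>i s. i < r \<Longrightarrow> s \<in> carrier R \<Longrightarrow> s \<otimes> f i \<in> Idl (f ` {..<i}) \<Longrightarrow> s \<in> Idl (f ` {..<i})"
    and P: "primeideal P R" "\<And>i. i < r \<Longrightarrow> f i \<in> P"
  shows "enat r \<le> prime_height R P"
proof -
  have "\<exists>Q :: nat \<Rightarrow> 'a set. (\<forall>i\<le>r. primeideal (Q i) R) \<and> (\<forall>i<r. Q i \<subset> Q (Suc i)) \<and> Q r = P"
    using assms
  proof (induction r arbitrary: P)
    case 0
    then show ?case by (intro exI[of _ "\<lambda>_. P"]) simp
  next
    case (Suc r)
    let ?J = "Idl (f ` {..<r})"
    have J: "ideal ?J R" using Suc.prems(1) by (intro genideal_ideal) auto
    have JP: "?J \<subseteq> P"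
      by (rule genideal_minimal[OF primeideal.axioms(1)[OF Suc.prems(3)]]) (use Suc.prems(4) in auto)
    obtain P' where P': "primeideal P' R" "?J \<subseteq> P'" "P' \<subset> P"
    proof (rule primeideal_strictly_below[OF J Suc.prems(3) JP])
      show "f r \<in> P" using Suc.prems(4) by simp
      show "s \<in> ?J" if "s \<in> carrier R" "s \<otimes> f r \<in> ?J" for s
        using Suc.prems(2)[of r s] that by simp
    qed (rule that)
    have "f ` {..<r} \<subseteq> ?J" using Suc.prems(1) by (intro genideal_self) auto
    then have fP': "f i \<in> P'" if "i < r" for i using that P'(2) by auto
    have "\<exists>Q :: nat \<Rightarrow> 'a set. (\<forall>i\<le>r. primeideal (Q i) R) \<and> (\<forall>i<r. Q i \<subset> Q (Suc i)) \<and> Q r = P'"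
      by (rule Suc.IH[OF _ _ P'(1) fP']) (use Suc.prems(1,2) in simp_all)
    then obtain Q where Q: "\<forall>i\<le>r. primeideal (Q i) R" "\<forall>i<r. Q i \<subset> Q (Suc i)" "Q r = P'"
      by (elim exE conjE) (rule that)
    show ?case
      by (rule exI[of _ "Q(Suc r := P)"]) (use Q P'(3) Suc.prems(3) in \<open>auto simp: le_Suc_eq less_Suc_eq\<close>)
  qed
  then show ?thesis unfolding prime_height_def by (intro Sup_upper) auto
qed


section \<open>Coprime initial monomials give regular sequences\<close>

definition weight :: "('v \<Rightarrow> nat) \<Rightarrow> ('v \<Rightarrow>\<^sub>0 nat) \<Rightarrow> nat" where
  "weight w m = (\<Sum>x\<in>Poly_Mapping.keys m. Poly_Mapping.lookup m x * w x)"

lemma weight_superset: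
  assumes "finite F" "Poly_Mapping.keys m \<subseteq> F"
  shows "weight w m = (\<Sum>x\<in>F. Poly_Mapping.lookup m x * w x)"
  unfolding weight_def using assms
  by (intro sum.mono_neutral_left) (auto simp: in_keys_iff)

lemma weight_add: "weight w (m + m') = weight w m + weight w m'"
proof -
  define F where "F = Poly_Mapping.keys m \<union> Poly_Mapping.keys m'"
  have F: "finite F" "Poly_Mapping.keys m \<subseteq> F" "Poly_Mapping.keys m' \<subseteq> F"
    "Poly_Mapping.keys (m + m') \<subseteq> F"
    using keys_add[of m m'] by (auto simp: F_def)
  show ?thesis
    unfolding F(2,3,4)[THEN weight_superset[OF F(1)]]
    by (simp add: lookup_add distrib_right sum.distrib)
qed

lemma weight_single [simp]: "weight w (Poly_Mapping.single x k) = k * w x"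
  by (cases "k = 0") (simp_all add: weight_def)

definition monomial_dvd :: "('v \<Rightarrow>\<^sub>0 nat) \<Rightarrow> ('v \<Rightarrow>\<^sub>0 nat) \<Rightarrow> bool" where
  "monomial_dvd \<mu> m \<longleftrightarrow> (\<forall>x. Poly_Mapping.lookup \<mu> x \<le> Poly_Mapping.lookup m x)"

lemma monomial_dvdE:
  assumes "monomial_dvd \<mu> m" obtains m' where "m = m' + \<mu>"
proof
  show "m = (m - \<mu>) + \<mu>"
    using assms by (intro poly_mapping_eqI) (simp add: monomial_dvd_def lookup_add lookup_minus)
qed

lemma monomial_dvd_add_coprime:
  assumes "monomial_dvd \<mu> (t + \<nu>)" "Poly_Mapping.keys \<mu> \<inter> Poly_Mapping.keys \<nu> = {}"
  shows "monomial_dvd \<mu> t"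
  unfolding monomial_dvd_def
proof
  fix x
  show "Poly_Mapping.lookup \<mu> x \<le> Poly_Mapping.lookup t x"
  proof (cases "x \<in> Poly_Mapping.keys \<mu>")
    case True
    then have "Poly_Mapping.lookup \<nu> x = 0" using assms(2) by (auto simp: in_keys_iff)
    then show ?thesis using assms(1) by (simp add: monomial_dvd_def lookup_add) (metis add_0_right)
  next
    case False
    then show ?thesis by (simp add: in_keys_iff)
  qed
qed

text \<open>Different monomials may have the same weight, so a weight does not order the monomials; therefore the initial monomial is
  required to be strictly heavier than all other monomials of \<open>f\<close>.\<close>

definition initial_monomial :: "('v \<Rightarrow> nat) \<Rightarrow> (('v \<Rightarrow>\<^sub>0 nat) \<Rightarrow>\<^sub>0 'k::comm_ring_1) \<Rightarrow> ('v \<Rightarrow>\<^sub>0 nat) \<Rightarrow> bool" where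
  "initial_monomial w f \<mu> \<longleftrightarrow> Poly_Mapping.lookup f \<mu> = 1 \<and>
     (\<forall>m\<in>Poly_Mapping.keys f. m \<noteq> \<mu> \<longrightarrow> weight w m < weight w \<mu>)"

definition combinations :: "'v set \<Rightarrow> ('i \<Rightarrow> ('v \<Rightarrow>\<^sub>0 nat) \<Rightarrow>\<^sub>0 'k::comm_ring_1) \<Rightarrow> 'i set \<Rightarrow> (('v \<Rightarrow>\<^sub>0 nat) \<Rightarrow>\<^sub>0 'k) set" where
  "combinations A f I = {(\<Sum>i\<in>I. s i * f i) | s. \<forall>i\<in>I. s i \<in> polys_in A}"

lemma combinations_add:
  assumes "p \<in> combinations A f I" "q \<in> combinations A f I"
  shows "p + q \<in> combinations A f I"
proof -
  obtain s t where "p = (\<Sum>i\<in>I. s i * f i)" "\<forall>i\<in>I. s i \<in> polys_in A"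
    "q = (\<Sum>i\<in>I. t i * f i)" "\<forall>i\<in>I. t i \<in> polys_in A"
    using assms by (auto simp: combinations_def)
  then show ?thesis unfolding combinations_def
    by (intro CollectI exI[of _ "\<lambda>i. s i + t i"])
      (simp add: distrib_right sum.distrib polys_in_add)
qed

lemma combinations_times:
  assumes "p \<in> combinations A f I" "q \<in> polys_in A"
  shows "q * p \<in> combinations A f I"
proof -
  obtain s where "p = (\<Sum>i\<in>I. s i * f i)" "\<forall>i\<in>I. s i \<in> polys_in A"
    using assms by (auto simp: combinations_def)
  then show ?thesis unfolding combinations_def using assms(2)
    by (intro CollectI exI[of _ "\<lambda>i. q * s i"])
      (simp add: sum_distrib_left mult.assoc polys_in_times)
qed

lemma combinations_zero [simp]: "0 \<in> combinations A f I"
  unfolding combinations_def by (intro CollectI exI[of _ "\<lambda>_. 0"]) simp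

lemma combinations_uminus:
  assumes "p \<in> combinations A f I" shows "- p \<in> combinations A f I"
  using combinations_times[OF assms, of "- 1"] by (simp add: polys_in_uminus)

lemma combinations_minus:
  assumes "p \<in> combinations A f I" "q \<in> combinations A f I"
  shows "p - q \<in> combinations A f I"
  using combinations_add[OF assms(1) combinations_uminus[OF assms(2)]] by simp

lemma combinations_generator:
  assumes "finite I" "i \<in> I" shows "f i \<in> combinations A f I"
  unfolding combinations_def
  by (intro CollectI exI[of _ "\<lambda>j. if j = i then 1 else 0"])
    (use assms in \<open>simp add: if_distrib[of "\<lambda>s. s * _"] sum.delta' cong: if_cong\<close>)

lemma combinations_insertE:
  assumes "finite I" "i \<notin> I" "h \<in> combinations A f (insert i I)"
  obtains a b where "h = a * f i + b" "a \<in> polys_in A" "b \<in> combinations A f I"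
  using assms by (fastforce simp: combinations_def)

definition standard :: "('i \<Rightarrow> 'v \<Rightarrow>\<^sub>0 nat) \<Rightarrow> 'i set \<Rightarrow> (('v \<Rightarrow>\<^sub>0 nat) \<Rightarrow>\<^sub>0 'k::comm_ring_1) \<Rightarrow> bool" where
  "standard \<mu> I p \<longleftrightarrow> (\<forall>m\<in>Poly_Mapping.keys p. \<forall>i\<in>I. \<not> monomial_dvd (\<mu> i) m)"

lemma standard_add: "standard \<mu> I p \<Longrightarrow> standard \<mu> I q \<Longrightarrow> standard \<mu> I (p + q)"
  using keys_add[of p q] unfolding standard_def by blast

lemma polys_in_single: "Poly_Mapping.keys m \<subseteq> A \<Longrightarrow> Poly_Mapping.single m c \<in> polys_in A"
  by (simp add: polys_in_def)

text \<open>Division with remainder: a monomial divisible by some \<open>\<mu> i\<close> is replaced, modulo \<open>f i\<close>, by lighter monomials.  So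
  induction on the weight applies, although there may be infinitely many monomials of a given weight.\<close>

lemma normal_form:
  fixes p :: "('v \<Rightarrow>\<^sub>0 nat) \<Rightarrow>\<^sub>0 'k::comm_ring_1"
  assumes I: "finite I" and f: "\<And>i. i \<in> I \<Longrightarrow> f i \<in> polys_in A"
    and \<mu>: "\<And>i. i \<in> I \<Longrightarrow> initial_monomial w (f i) (\<mu> i)"
    and p: "p \<in> polys_in A"
  obtains q where "q \<in> polys_in A" "standard \<mu> I q" "p - q \<in> combinations A f I"
proof -
  define NF where "NF = {p. \<exists>q\<in>polys_in A. standard \<mu> I q \<and> p - q \<in> combinations A f I}"
  have NF_add: "p + q \<in> NF" if pq: "p \<in> NF" "q \<in> NF" for p q
  proof -
    obtain p' q' where "p' \<in> polys_in A" "standard \<mu> I p'" "p - p' \<in> combinations A f I"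
      "q' \<in> polys_in A" "standard \<mu> I q'" "q - q' \<in> combinations A f I"
      using pq by (auto simp: NF_def)
    then show ?thesis unfolding NF_def
      using combinations_add[of "p - p'" A f I "q - q'"]
      by (intro CollectI bexI[of _ "p' + q'"])
        (simp_all add: polys_in_add standard_add algebra_simps)
  qed
  have NF_comb: "p \<in> NF" if "p \<in> combinations A f I" for p
    using that unfolding NF_def by (intro CollectI bexI[of _ 0]) (auto simp: standard_def)
  have NF_zero: "0 \<in> NF" by (rule NF_comb) simp
  have mono: "Poly_Mapping.single m c \<in> NF" if "Poly_Mapping.keys m \<subseteq> A" for m c
    using that
  proof (induction "weight w m" arbitrary: m c rule: less_induct)
    case less
    show ?case
    proof (cases "\<exists>i\<in>I. monomial_dvd (\<mu> i) m")
      case False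
      then show ?thesis unfolding NF_def using less.prems
        by (intro CollectI bexI[of _ "Poly_Mapping.single m c"]) (auto simp: standard_def polys_in_def)
    next
      case True
      then obtain i m' where i: "i \<in> I" "m = m' + \<mu> i" by (metis monomial_dvdE)
      have m': "Poly_Mapping.keys m' \<subseteq> A"
        using less.prems unfolding i(2) by (auto simp: in_keys_iff lookup_add)
      define g where "g = f i - Poly_Mapping.single (\<mu> i) 1"
      define r where "r = Poly_Mapping.single m' c * g"
      have g: "weight w k < weight w (\<mu> i)" if k: "k \<in> Poly_Mapping.keys g" for k
      proof -
        have "k \<noteq> \<mu> i" "k \<in> Poly_Mapping.keys (f i)"
          using k \<mu>[OF i(1)] by (auto simp: g_def in_keys_iff lookup_minus lookup_single when_def
              initial_monomial_def split: if_splits)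
        then show ?thesis using \<mu>[OF i(1)] by (simp add: initial_monomial_def)
      qed
      have fA: "Poly_Mapping.single m' c * f i \<in> polys_in A" "Poly_Mapping.single m c \<in> polys_in A"
        by (intro polys_in_times polys_in_single m' less.prems f i(1))+
      have eq: "Poly_Mapping.single m c = Poly_Mapping.single m' c * f i + (- r)"
        by (simp add: r_def g_def i(2) right_diff_distrib mult_single)
      then have "- r = Poly_Mapping.single m c + - (Poly_Mapping.single m' c * f i)" by simp
      then have rA: "- r \<in> polys_in A" using fA by (simp only: polys_in_add polys_in_uminus)
      have "- r \<in> NF"
      proof (rule poly_induct[where p = "- r" and P = "\<lambda>p. p \<in> NF"])
        fix k e assume k: "k \<in> Poly_Mapping.keys (- r)"
        then have "k \<in> Poly_Mapping.keys (Poly_Mapping.single m' c * g)" by (simp add: r_def)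
        then obtain k' where "k = m' + k'" "k' \<in> Poly_Mapping.keys g"
          using keys_mult[of "Poly_Mapping.single m' c" g] by (auto split: if_splits)
        then have "weight w k < weight w m" using g by (simp add: i(2) weight_add)
        moreover have "Poly_Mapping.keys k \<subseteq> A" using k rA by (auto simp: polys_in_def)
        ultimately show "Poly_Mapping.single k e \<in> NF" by (rule less.hyps)
      qed (auto intro: NF_zero NF_add)
      moreover have "Poly_Mapping.single m' c * f i \<in> NF"
        by (intro NF_comb combinations_times combinations_generator I i) (rule polys_in_single[OF m'])
      ultimately show ?thesis unfolding eq by (intro NF_add)
    qed
  qed
  have "p \<in> NF"
  proof (induction p rule: poly_induct)
    case (single m c)
    then show ?case using p by (intro mono) (auto simp: polys_in_def)
  qed (auto intro: NF_zero NF_add)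
  then show thesis using that by (auto simp: NF_def)
qed

lemma lookup_times_monomial:
  "Poly_Mapping.lookup (p * Poly_Mapping.single \<mu> 1) (t + \<mu>)
     = Poly_Mapping.lookup (p :: ('v \<Rightarrow>\<^sub>0 nat) \<Rightarrow>\<^sub>0 'k::comm_ring_1) t"
proof (induction p rule: poly_induct)
  case (single m c)
  show ?case by (simp add: mult_single lookup_single when_def)
qed (simp_all add: distrib_right lookup_add)

text \<open>The heaviest terms of \<open>s\<close>, multiplied with the initial monomial of \<open>f\<close>, cannot cancel in the product, because all
  other contributions are lighter.\<close>

lemma initial_monomial_times:
  fixes s f :: "('v \<Rightarrow>\<^sub>0 nat) \<Rightarrow>\<^sub>0 'k::comm_ring_1"
  assumes f: "initial_monomial w f \<mu>" and s: "s \<noteq> 0"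
  obtains t where "t \<in> Poly_Mapping.keys s" "t + \<mu> \<in> Poly_Mapping.keys (s * f)"
    "\<And>m. m \<in> Poly_Mapping.keys (s * f) \<Longrightarrow>
       weight w m < weight w (t + \<mu>) \<or> weight w m = weight w (t + \<mu>) \<and> monomial_dvd \<mu> m"
proof -
  define T where "T = Max (weight w ` Poly_Mapping.keys s)"
  have ne: "weight w ` Poly_Mapping.keys s \<noteq> {}" using s by auto
  have T: "weight w k \<le> T" if "k \<in> Poly_Mapping.keys s" for k
    using that by (simp add: T_def)
  obtain t where t: "t \<in> Poly_Mapping.keys s" "weight w t = T"
    using Max_in[OF _ ne] by (auto simp: T_def)
  define g where "g = f - Poly_Mapping.single \<mu> 1"
  have g: "weight w k < weight w \<mu>" if k: "k \<in> Poly_Mapping.keys g" for k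
  proof -
    have "k \<noteq> \<mu>" "k \<in> Poly_Mapping.keys f"
      using k f by (auto simp: g_def in_keys_iff lookup_minus lookup_single when_def
          initial_monomial_def split: if_splits)
    then show ?thesis using f by (simp add: initial_monomial_def)
  qed
  have sg: "weight w m < T + weight w \<mu>" if "m \<in> Poly_Mapping.keys (s * g)" for m
  proof -
    obtain a b where "m = a + b" "a \<in> Poly_Mapping.keys s" "b \<in> Poly_Mapping.keys g"
      using keys_mult[of s g] \<open>m \<in> _\<close> by blast
    then show ?thesis using T g by (simp add: weight_add add_le_less_mono)
  qed
  have eq: "s * f = s * Poly_Mapping.single \<mu> 1 + s * g"
    by (simp add: g_def algebra_simps)
  have "Poly_Mapping.lookup (s * g) (t + \<mu>) = 0"
    using sg[of "t + \<mu>"] t by (auto simp: weight_add in_keys_iff)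
  then have "Poly_Mapping.lookup (s * f) (t + \<mu>) = Poly_Mapping.lookup s t"
    by (simp add: eq lookup_add lookup_times_monomial)
  then have "t + \<mu> \<in> Poly_Mapping.keys (s * f)" using t by (simp add: in_keys_iff)
  moreover have "weight w m < weight w (t + \<mu>) \<or> weight w m = weight w (t + \<mu>) \<and> monomial_dvd \<mu> m"
    if m: "m \<in> Poly_Mapping.keys (s * f)" for m
  proof -
    have "m \<in> Poly_Mapping.keys (s * Poly_Mapping.single \<mu> 1) \<or> m \<in> Poly_Mapping.keys (s * g)"
      using m keys_add[of "s * Poly_Mapping.single \<mu> 1" "s * g"] unfolding eq by blast
    then show ?thesis
    proof
      assume "m \<in> Poly_Mapping.keys (s * Poly_Mapping.single \<mu> 1)"
      then obtain a where "m = a + \<mu>" "a \<in> Poly_Mapping.keys s"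
        using keys_mult[of s "Poly_Mapping.single \<mu> 1"] by (auto split: if_splits)
      then show ?thesis using T t by (auto simp: weight_add monomial_dvd_def lookup_add order_less_le)
    next
      assume "m \<in> Poly_Mapping.keys (s * g)"
      then show ?thesis using sg t by (simp add: weight_add)
    qed
  qed
  ultimately show thesis using that t by blast
qed

text \<open>Polynomials with pairwise coprime initial monomials form a Groebner basis.  Write \<open>h = a * f i + b\<close> with
  \<open>b\<close> in the ideal of the other polynomials and \<open>a\<close> reduced modulo them.  The heaviest terms of \<open>a * f i\<close> include one
  that is divisible by no other initial monomial \<open>\<mu> j\<close> (here coprimality enters), while by induction all
  heaviest terms of \<open>b\<close> are divisible by some \<open>\<mu> j\<close>.  So the two cannot cancel, and the heaviest terms
  of \<open>h\<close> come from those of the summands.\<close>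

lemma top_monomial_divisible:
  fixes f :: "'i \<Rightarrow> ('v \<Rightarrow>\<^sub>0 nat) \<Rightarrow>\<^sub>0 'k::comm_ring_1"
  assumes "finite I" and f: "\<And>i. i \<in> I \<Longrightarrow> f i \<in> polys_in A"
    and \<mu>: "\<And>i. i \<in> I \<Longrightarrow> initial_monomial w (f i) (\<mu> i)"
    and coprime: "\<And>i j. i \<in> I \<Longrightarrow> j \<in> I \<Longrightarrow> i \<noteq> j \<Longrightarrow>
      Poly_Mapping.keys (\<mu> i) \<inter> Poly_Mapping.keys (\<mu> j) = {}"
    and h: "h \<in> combinations A f I" "m \<in> Poly_Mapping.keys h"
      "\<And>k. k \<in> Poly_Mapping.keys h \<Longrightarrow> weight w k \<le> weight w m"
  shows "\<exists>i\<in>I. monomial_dvd (\<mu> i) m"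
  using assms
proof (induction I arbitrary: h m rule: finite_induct)
  case empty
  then show ?case by (auto simp: combinations_def)
next
  case (insert i I)
  obtain a b where ab: "h = a * f i + b" "a \<in> polys_in A" "b \<in> combinations A f I"
    using combinations_insertE insert.hyps insert.prems(4) by metis
  obtain a' where a': "a' \<in> polys_in A" "standard \<mu> I a'" "a - a' \<in> combinations A f I"
    using normal_form[OF insert.hyps(1) _ _ ab(2), of f w \<mu>] insert.prems(1,2) by auto
  define b' where "b' = b + f i * (a - a')"
  have b': "b' \<in> combinations A f I"
    unfolding b'_def by (intro combinations_add ab(3) combinations_times a'(3) insert.prems(1)) simp
  have h: "h = a' * f i + b'" by (simp add: ab(1) b'_def algebra_simps)
  have IH: "\<exists>j\<in>I. monomial_dvd (\<mu> j) m" if "m \<in> Poly_Mapping.keys b'"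
    "\<And>k. k \<in> Poly_Mapping.keys b' \<Longrightarrow> weight w k \<le> weight w m" for m
    using insert.IH[OF _ _ _ b' that] insert.prems(1-3) by auto
  show ?case
  proof (cases "a' = 0")
    case True
    then show ?thesis using IH[of m] insert.prems(5,6) h by auto
  next
    case False
    obtain t where t: "t \<in> Poly_Mapping.keys a'" "t + \<mu> i \<in> Poly_Mapping.keys (a' * f i)"
      "\<And>m. m \<in> Poly_Mapping.keys (a' * f i) \<Longrightarrow> weight w m < weight w (t + \<mu> i)
         \<or> weight w m = weight w (t + \<mu> i) \<and> monomial_dvd (\<mu> i) m"
      using initial_monomial_times[OF insert.prems(2)[of i] False] by blast
    have t_nd: "\<not> monomial_dvd (\<mu> j) (t + \<mu> i)" if "j \<in> I" for j
    proof
      assume "monomial_dvd (\<mu> j) (t + \<mu> i)"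
      moreover have "Poly_Mapping.keys (\<mu> j) \<inter> Poly_Mapping.keys (\<mu> i) = {}"
        using insert.prems(3)[of j i] insert.hyps(2) that by auto
      ultimately have "monomial_dvd (\<mu> j) t" by (rule monomial_dvd_add_coprime)
      then show False using a'(2) t(1) that by (auto simp: standard_def)
    qed
    \<comment> \<open>If a heaviest monomial of \<open>b'\<close> cancels, then \<open>t + \<mu> i\<close> is at least as heavy; being divisible
      by no \<open>\<mu> j\<close>, it then survives in \<open>h\<close>.\<close>
    have top_b': "weight w k \<le> weight w m" if k: "k \<in> Poly_Mapping.keys b'" for k
    proof -
      define B where "B = Max (weight w ` Poly_Mapping.keys b')"
      have "weight w ` Poly_Mapping.keys b' \<noteq> {}" using k by auto
      from Max_in[OF _ this] obtain l where l: "l \<in> Poly_Mapping.keys b'" "weight w l = B"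
        by (auto simp: B_def)
      have B: "weight w k \<le> B" if "k \<in> Poly_Mapping.keys b'" for k
        using that by (simp add: B_def)
      obtain j where j: "j \<in> I" "monomial_dvd (\<mu> j) l" using IH[OF l(1)] B l(2) by auto
      show ?thesis
      proof (cases "l \<in> Poly_Mapping.keys h")
        case True
        then show ?thesis using insert.prems(6)[OF True] B[OF k] l(2) by simp
      next
        case False
        then have "l \<in> Poly_Mapping.keys (a' * f i)"
          using l(1) by (auto simp: h lookup_add in_keys_iff)
        then have lt: "B \<le> weight w (t + \<mu> i)" using t(3)[of l] l(2) by auto
        have "t + \<mu> i \<in> Poly_Mapping.keys h"
        proof (rule ccontr)
          assume "t + \<mu> i \<notin> Poly_Mapping.keys h"
          then have "t + \<mu> i \<in> Poly_Mapping.keys b'"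
            using t(2) by (auto simp: h lookup_add in_keys_iff)
          then show False using IH[of "t + \<mu> i"] B lt t_nd by (meson order_trans)
        qed
        then show ?thesis using insert.prems(6) lt B[OF k] by (meson order_trans)
      qed
    qed
    have top_af: "weight w (t + \<mu> i) \<le> weight w m"
    proof (cases "t + \<mu> i \<in> Poly_Mapping.keys h")
      case False
      then have "t + \<mu> i \<in> Poly_Mapping.keys b'"
        using t(2) by (auto simp: h lookup_add in_keys_iff)
      then show ?thesis by (rule top_b')
    qed (rule insert.prems(6))
    have "m \<in> Poly_Mapping.keys (a' * f i) \<or> m \<in> Poly_Mapping.keys b'"
      using insert.prems(5) keys_add[of "a' * f i" b'] unfolding h by blast
    then show ?thesis
    proof
      assume "m \<in> Poly_Mapping.keys (a' * f i)"
      then show ?thesis using t(3)[of m] top_af by auto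
    next
      assume "m \<in> Poly_Mapping.keys b'"
      then show ?thesis using IH[of m] top_b' by auto
    qed
  qed
qed

text \<open>If a nonzero \<open>q\<close> is reduced modulo the polynomials indexed by \<open>I\<close>, then \<open>q * f i\<close> has a heaviest monomial
  that is divisible by none of their initial monomials, so \<open>q * f i\<close> is not in their ideal.\<close>

theorem coprime_initial_monomials_regular:
  fixes f :: "'i \<Rightarrow> ('v \<Rightarrow>\<^sub>0 nat) \<Rightarrow>\<^sub>0 'k::comm_ring_1"
  assumes "finite I" "i \<notin> I" and f: "\<And>j. j \<in> insert i I \<Longrightarrow> f j \<in> polys_in A"
    and \<mu>: "\<And>j. j \<in> insert i I \<Longrightarrow> initial_monomial w (f j) (\<mu> j)"
    and coprime: "\<And>j k. j \<in> insert i I \<Longrightarrow> k \<in> insert i I \<Longrightarrow> j \<noteq> k \<Longrightarrow>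
      Poly_Mapping.keys (\<mu> j) \<inter> Poly_Mapping.keys (\<mu> k) = {}"
    and s: "s \<in> polys_in A" "s * f i \<in> combinations A f I"
  shows "s \<in> combinations A f I"
proof -
  obtain q where q: "q \<in> polys_in A" "standard \<mu> I q" "s - q \<in> combinations A f I"
    using normal_form[OF assms(1) _ _ s(1), of f w \<mu>] f \<mu> by auto
  have "f i * (s - q) \<in> combinations A f I"
    by (rule combinations_times[OF q(3)]) (simp add: f)
  from combinations_minus[OF s(2) this] have qf: "q * f i \<in> combinations A f I"
    by (simp add: algebra_simps)
  have "q = 0"
  proof (rule ccontr)
    assume "q \<noteq> 0"
    then obtain t where t: "t \<in> Poly_Mapping.keys q" "t + \<mu> i \<in> Poly_Mapping.keys (q * f i)"
      and top: "\<And>m. m \<in> Poly_Mapping.keys (q * f i) \<Longrightarrow> weight w m < weight w (t + \<mu> i)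
         \<or> weight w m = weight w (t + \<mu> i) \<and> monomial_dvd (\<mu> i) m"
      using initial_monomial_times[OF \<mu>[of i]] by blast
    have le: "weight w m \<le> weight w (t + \<mu> i)" if "m \<in> Poly_Mapping.keys (q * f i)" for m
      using top[OF that] by auto
    have "\<exists>j\<in>I. monomial_dvd (\<mu> j) (t + \<mu> i)"
      by (rule top_monomial_divisible[OF assms(1) _ _ _ qf t(2) le]) (simp_all add: f \<mu> coprime)
    then obtain j where j: "j \<in> I" "monomial_dvd (\<mu> j) (t + \<mu> i)" by blast
    have "j \<noteq> i" using j(1) assms(2) by blast
    then have "Poly_Mapping.keys (\<mu> j) \<inter> Poly_Mapping.keys (\<mu> i) = {}"
      using j(1) by (intro coprime) simp_all
    then have "monomial_dvd (\<mu> j) t" by (rule monomial_dvd_add_coprime[OF j(2)])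
    then show False using q(2) t(1) j(1) by (auto simp: standard_def)
  qed
  then show ?thesis using q(3) by simp
qed

lemma genideal_LSS_ring_eq_combinations:
  fixes f :: "'i \<Rightarrow> 'k::field mpoly"
  assumes "finite I" "\<And>i. i \<in> I \<Longrightarrow> f i \<in> carrier (LSS_ring n d)"
  shows "genideal (LSS_ring n d) (f ` I) = combinations ({1..n} \<times> {1..d}) f I"
proof
  let ?R = "LSS_ring n d :: 'k mpoly ring" and ?A = "{1..n} \<times> {1..d}"
  interpret cring ?R by (rule LSS_ring_cring)
  have fA: "f i \<in> polys_in ?A" if "i \<in> I" for i using assms(2)[OF that] by (simp add: carrier_LSS_ring)
  have sub: "combinations ?A f I \<subseteq> carrier ?R"
    by (auto simp: combinations_def carrier_LSS_ring simp del: One_nat_def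
        intro!: polys_in_sum polys_in_times fA)
  have "ideal (combinations ?A f I) ?R"
    by (rule LSS_ring_idealI[OF sub])
      (auto simp: carrier_LSS_ring intro: combinations_add combinations_times)
  then show "Idl\<^bsub>?R\<^esub> (f ` I) \<subseteq> combinations ?A f I"
    by (rule genideal_minimal) (auto intro: combinations_generator assms(1))
  have id: "ideal (Idl\<^bsub>?R\<^esub> (f ` I)) ?R" by (rule genideal_ideal) (use assms(2) in auto)
  interpret J: ideal "Idl\<^bsub>?R\<^esub> (f ` I)" ?R by (rule id)
  have zero: "0 \<in> Idl\<^bsub>?R\<^esub> (f ` I)" using additive_subgroup.zero_closed[OF J.is_additive_subgroup] by simp
  have gen: "f i \<in> Idl\<^bsub>?R\<^esub> (f ` I)" if "i \<in> I" for i
    using genideal_self[of "f ` I"] assms(2) that by auto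
  show "combinations ?A f I \<subseteq> Idl\<^bsub>?R\<^esub> (f ` I)"
  proof
    fix h assume "h \<in> combinations ?A f I"
    then obtain s where s: "h = (\<Sum>i\<in>I. s i * f i)" "\<forall>i\<in>I. s i \<in> polys_in ?A"
      by (auto simp: combinations_def)
    have "(\<Sum>i\<in>F. s i * f i) \<in> Idl\<^bsub>?R\<^esub> (f ` I)" if "finite F" "F \<subseteq> I" for F
      using that
    proof (induction F rule: finite_induct)
      case empty
      then show ?case using zero by simp
    next
      case (insert i F)
      then have "s i * f i \<in> Idl\<^bsub>?R\<^esub> (f ` I)"
        using J.I_l_closed[OF gen, of i "s i"] s(2) by (simp add: carrier_LSS_ring)
      then show ?case
        using additive_subgroup.a_closed[OF J.is_additive_subgroup] insert by fastforce
    qed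
    then show "h \<in> Idl\<^bsub>?R\<^esub> (f ` I)" using s(1) assms(1) by auto
  qed
qed

theorem ideal_height_ge_coprime_initial_monomials:
  fixes f :: "nat \<Rightarrow> 'k::field mpoly"
  assumes f: "\<And>i. i < r \<Longrightarrow> f i \<in> carrier (LSS_ring n d)"
    and \<mu>: "\<And>i. i < r \<Longrightarrow> initial_monomial w (f i) (\<mu> i)"
    and coprime: "\<And>i j. i < r \<Longrightarrow> j < r \<Longrightarrow> i \<noteq> j \<Longrightarrow>
      Poly_Mapping.keys (\<mu> i) \<inter> Poly_Mapping.keys (\<mu> j) = {}"
  shows "enat r \<le> ideal_height (LSS_ring n d) (genideal (LSS_ring n d) (f ` {..<r}))"
  unfolding ideal_height_def
proof (rule Inf_greatest, clarify)
  let ?R = "LSS_ring n d :: 'k mpoly ring" and ?A = "{1..n} \<times> {1..d}"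
  interpret cring ?R by (rule LSS_ring_cring)
  fix P assume P: "primeideal P ?R" "Idl\<^bsub>?R\<^esub> (f ` {..<r}) \<subseteq> P"
  show "enat r \<le> prime_height ?R P"
  proof (rule prime_height_ge_regular_sequence[of r f, OF f _ P(1)])
    fix i assume i: "i < r"
    show "f i \<in> P" using genideal_self[of "f ` {..<r}"] f P(2) i by auto
    fix s assume s: "s \<in> carrier ?R" "s \<otimes>\<^bsub>?R\<^esub> f i \<in> Idl\<^bsub>?R\<^esub> (f ` {..<i})"
    have J: "Idl\<^bsub>?R\<^esub> (f ` {..<i}) = combinations ?A f {..<i}"
      by (rule genideal_LSS_ring_eq_combinations) (use f i in auto)
    show "s \<in> Idl\<^bsub>?R\<^esub> (f ` {..<i})" unfolding J
    proof (rule coprime_initial_monomials_regular[of "{..<i}" i f ?A w \<mu>])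
      show "s * f i \<in> combinations ?A f {..<i}" using s(2) by (simp add: J)
      show "Poly_Mapping.keys (\<mu> j) \<inter> Poly_Mapping.keys (\<mu> k) = {}"
        if "j \<in> insert i {..<i}" "k \<in> insert i {..<i}" "j \<noteq> k" for j k
        using that i by (intro coprime) auto
    qed (use s i f \<mu> in \<open>auto simp: carrier_LSS_ring\<close>)
  qed
qed


section \<open>The generators of an LSS ideal\<close>

text \<open>The two ends are told apart by their size, so that generator and monomials are functions of the edge as a set.\<close>

definition edge_monomial :: "nat set \<Rightarrow> nat \<Rightarrow> (nat \<times> nat) \<Rightarrow>\<^sub>0 nat" where
  "edge_monomial e l = Poly_Mapping.single (Min e, l) 1 + Poly_Mapping.single (Max e, l) 1"

definition edge_gen :: "nat \<Rightarrow> nat set \<Rightarrow> 'k::field mpoly" where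
  "edge_gen d e = (\<Sum>l=1..d. Poly_Mapping.single (edge_monomial e l) 1)"

lemma card_2_Min_Max:
  fixes e :: "nat set"
  assumes "card e = 2" shows "e = {Min e, Max e}" "Min e < Max e"
proof -
  obtain a b where "e = {a, b}" "a \<noteq> b" using assms by (auto simp: card_2_iff)
  then show "e = {Min e, Max e}" "Min e < Max e" by (auto simp: min_def max_def)
qed

lemma edge_gen_doubleton: "i \<noteq> j \<Longrightarrow> edge_gen d {i, j} = LSS_gen d i j"
  by (cases "i < j")
    (auto simp: edge_gen_def edge_monomial_def LSS_gen_def var_def mult_single min_def max_def
      add.commute intro!: sum.cong)

lemma LSS_gens_eq_edge_gens:
  assumes "simple_graph V E"
  shows "{LSS_gen d i j | i j. {i, j} \<in> E} = edge_gen d ` E"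
proof -
  have 2: "card e = 2" if "e \<in> E" for e using assms that by (simp add: simple_graph_def)
  have "LSS_gen d i j \<in> edge_gen d ` E" if "{i, j} \<in> E" for i j
  proof -
    have "i \<noteq> j" using 2[OF that] by auto
    from edge_gen_doubleton[OF this, of d] show ?thesis using that by (metis imageI)
  qed
  moreover have "\<exists>i j. edge_gen d e = LSS_gen d i j \<and> {i, j} \<in> E" if e: "e \<in> E" for e
  proof -
    obtain i j where "e = {i, j}" "i \<noteq> j" using 2[OF e] by (auto simp: card_2_iff)
    then show ?thesis using e edge_gen_doubleton by blast
  qed
  ultimately show ?thesis by blast
qed

lemma LSS_ideal_eq_genideal_edge_gen:
  "simple_graph {1..n} E \<Longrightarrow> LSS_ideal n E d = genideal (LSS_ring n d) (edge_gen d ` E)"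
  unfolding LSS_ideal_def by (simp only: LSS_gens_eq_edge_gens)

lemma edge_gen_carrier:
  assumes "simple_graph {1..n} E" "e \<in> E"
  shows "(edge_gen d e :: 'k::field mpoly) \<in> carrier (LSS_ring n d)"
proof -
  have e: "e \<subseteq> {1..n}" "card e = 2" using assms by (auto simp only: simple_graph_def)
  note mm = card_2_Min_Max[OF e(2)]
  have "(LSS_gen d (Min e) (Max e) :: 'k mpoly) \<in> carrier (LSS_ring n d)"
    by (rule LSS_gen_in_carrier) (use e(1) mm(1) in blast)+
  moreover have "edge_gen d e = (LSS_gen d (Min e) (Max e) :: 'k mpoly)"
    using edge_gen_doubleton[OF less_imp_neq[OF mm(2)], of d, folded mm(1)] .
  ultimately show ?thesis by simp
qed

lemma edge_monomial_eq_iff: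
  assumes "card e = 2" "card e' = 2"
  shows "edge_monomial e l = edge_monomial e' l' \<longleftrightarrow> e = e' \<and> l = l'"
proof
  note m = card_2_Min_Max[OF assms(1)] card_2_Min_Max[OF assms(2)]
  assume eq: "edge_monomial e l = edge_monomial e' l'"
  have "Poly_Mapping.lookup (edge_monomial e' l') (Min e, l) > 0"
    "Poly_Mapping.lookup (edge_monomial e' l') (Max e, l) > 0"
    unfolding eq[symmetric] by (simp_all add: edge_monomial_def lookup_add)
  then have "(Min e, l) \<in> {(Min e', l'), (Max e', l')}" "(Max e, l) \<in> {(Min e', l'), (Max e', l')}"
    by (auto simp: edge_monomial_def lookup_add lookup_single when_def split: if_splits)
  then have eqs: "l = l'" "Min e = Min e'" "Max e = Max e'" using m(2,4) by auto
  have "e = {Min e', Max e'}" unfolding eqs(2,3)[symmetric] by (rule m(1))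
  also have "\<dots> = e'" by (rule m(3)[symmetric])
  finally show "e = e' \<and> l = l'" using eqs(1) by simp
qed simp

lemma keys_edge_monomial:
  assumes "card e = 2" shows "Poly_Mapping.keys (edge_monomial e l) = e \<times> {l}"
proof -
  have "Poly_Mapping.keys (edge_monomial e l) = {Min e, Max e} \<times> {l}"
    by (rule Set.set_eqI) (auto simp: edge_monomial_def in_keys_iff lookup_add lookup_single when_def)
  then show ?thesis by (simp flip: card_2_Min_Max(1)[OF assms])
qed

lemma keys_edge_gen: "Poly_Mapping.keys (edge_gen d e :: 'k::field mpoly) \<subseteq> edge_monomial e ` {1..d}"
proof
  fix m assume m: "m \<in> Poly_Mapping.keys (edge_gen d e :: 'k mpoly)"
  show "m \<in> edge_monomial e ` {1..d}"
  proof (rule ccontr)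
    assume "m \<notin> edge_monomial e ` {1..d}"
    then have "Poly_Mapping.lookup (edge_gen d e :: 'k mpoly) m = 0"
      unfolding edge_gen_def lookup_sum by (intro sum.neutral) (auto simp: lookup_single when_def)
    then show False using m by (simp add: in_keys_iff)
  qed
qed

lemma lookup_edge_gen:
  assumes "card e = 2" "card e' = 2" "l \<in> {1..d}"
  shows "Poly_Mapping.lookup (edge_gen d e :: 'k::field mpoly) (edge_monomial e' l)
           = (if e = e' then 1 else 0)"
proof -
  have "Poly_Mapping.lookup (edge_gen d e :: 'k mpoly) (edge_monomial e' l)
      = (\<Sum>k=1..d. if l = k then (if e = e' then 1 else 0) else 0)"
    unfolding edge_gen_def lookup_sum
    by (rule sum.cong) (auto simp: lookup_single when_def edge_monomial_eq_iff assms)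
  then show ?thesis using assms(3) by simp
qed

lemma weight_edge_monomial: "weight w (edge_monomial e l) = w (Min e, l) + w (Max e, l)"
  by (simp add: edge_monomial_def weight_add)

lemma lookup_times_at_zero:
  fixes p q :: "('v \<Rightarrow>\<^sub>0 nat) \<Rightarrow>\<^sub>0 'k::comm_ring_1"
  shows "Poly_Mapping.lookup (p * q) 0 = Poly_Mapping.lookup p 0 * Poly_Mapping.lookup q 0"
proof (induction p rule: poly_induct)
  case (single m c)
  show ?case
  proof (induction q rule: poly_induct)
    case (single m' c')
    have "m + m' = 0 \<longleftrightarrow> m = 0 \<and> m' = 0"
      by (auto simp: poly_mapping_eq_iff fun_eq_iff lookup_add)
    then show ?case by (simp add: mult_single lookup_single when_def)
  qed (simp_all add: distrib_left lookup_add)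
qed (simp_all add: distrib_right lookup_add)

text \<open>All monomials of the generators have degree two, so only the constant term of \<open>p\<close> contributes in degree two.\<close>

lemma lookup_times_edge_gen:
  fixes p :: "'k::field mpoly"
  shows "Poly_Mapping.lookup (p * edge_gen d e) (edge_monomial e' l)
     = Poly_Mapping.lookup p 0 * Poly_Mapping.lookup (edge_gen d e) (edge_monomial e' l)"
proof (induction p rule: poly_induct)
  case (single m c)
  have "m + edge_monomial e k = edge_monomial e' l \<longleftrightarrow> m = 0 \<and> edge_monomial e k = edge_monomial e' l" for k
  proof
    assume eq: "m + edge_monomial e k = edge_monomial e' l"
    from arg_cong[OF this, of "weight (\<lambda>_. 1)"] have "weight (\<lambda>_. 1) m = 0"
      by (simp add: weight_add weight_edge_monomial)
    then have wz: "\<forall>x\<in>Poly_Mapping.keys m. Poly_Mapping.lookup m x * 1 = 0"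
      by (simp only: weight_def sum_eq_0_iff finite_keys)
    have z: "Poly_Mapping.lookup m x = 0" for x
    proof (cases "x \<in> Poly_Mapping.keys m")
      case True
      with wz have "Poly_Mapping.lookup m x * 1 = 0" by (rule bspec)
      then show ?thesis by simp
    qed (simp add: in_keys_iff)
    have "m = 0" by (rule poly_mapping_eqI) (simp only: z lookup_zero)
    then show "m = 0 \<and> edge_monomial e k = edge_monomial e' l" using eq by simp
  qed simp
  then show ?case
    by (auto simp: edge_gen_def sum_distrib_left mult_single lookup_sum lookup_single when_def
        intro!: sum.cong)
qed (simp_all add: distrib_right lookup_add)

text \<open>Compare quadratic parts: if \<open>B\<close> generates the ideal, each \<open>f\<^sub>e\<close> is the combination of the quadratic parts of the elements of
  \<open>B\<close> whose coefficients are the constant terms of the cofactors.  The \<open>f\<^sub>e\<close> are linearly independent, which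
  is seen at the monomials \<open>x\<^bsub>i,1\<^esub> x\<^bsub>j,1\<^esub>\<close>, so \<open>B\<close> has at least as many elements as there are edges.\<close>

theorem min_num_generators_LSS_ideal:
  assumes G: "simple_graph {1..n} E" and d: "d > 0"
  shows "min_num_generators (LSS_ring n d) (LSS_ideal n E d :: 'k::field mpoly set) = enat (card E)"
proof (rule antisym)
  let ?R = "LSS_ring n d :: 'k mpoly ring" and ?I = "LSS_ideal n E d :: 'k mpoly set"
  let ?g = "edge_gen d :: nat set \<Rightarrow> 'k mpoly" and ?A = "{1..n} \<times> {1..d}"
  have fE: "finite E" using G finite_subset[of E "Pow {1..n}"] by (auto simp: simple_graph_def)
  have 2: "card e = 2" if "e \<in> E" for e using G that by (simp add: simple_graph_def)
  have I: "?I = genideal ?R (?g ` E)" using G by (rule LSS_ideal_eq_genideal_edge_gen)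
  have gR: "?g ` E \<subseteq> carrier ?R" using edge_gen_carrier[OF G] by blast
  have "min_num_generators ?R ?I \<le> enat (card (?g ` E))"
    unfolding min_num_generators_def using I gR fE by (intro Inf_lower) blast
  also have "\<dots> \<le> enat (card E)" using card_image_le[OF fE] by simp
  finally show "min_num_generators ?R ?I \<le> enat (card E)" .
  show "enat (card E) \<le> min_num_generators ?R ?I"
    unfolding min_num_generators_def
  proof (rule Inf_greatest, clarify)
    fix B assume B: "finite B" "B \<subseteq> carrier ?R" "genideal ?R B = ?I"
    have comb: "?I = combinations ?A id B" "?I = combinations ?A ?g E"
    proof -
      have "genideal ?R (id ` B) = combinations ?A id B"
        by (rule genideal_LSS_ring_eq_combinations[OF B(1)]) (use B(2) in auto)
      then show "?I = combinations ?A id B" using B(3) by simp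
      have "genideal ?R (?g ` E) = combinations ?A ?g E"
        by (rule genideal_LSS_ring_eq_combinations[OF fE]) (use gR in auto)
      then show "?I = combinations ?A ?g E" using I by simp
    qed
    let ?m = "\<lambda>e. edge_monomial e 1"
    have "?g e \<in> ?I" if "e \<in> E" for e
      unfolding comb(2) by (rule combinations_generator[OF fE that])
    then have "\<forall>e\<in>E. \<exists>s. ?g e = (\<Sum>b\<in>B. s b * b)"
      unfolding comb(1) by (auto simp: combinations_def)
    from bchoice[OF this] obtain s where s: "\<And>e. e \<in> E \<Longrightarrow> ?g e = (\<Sum>b\<in>B. s e b * b)" by blast
    have quad: "Poly_Mapping.lookup (q * b) (?m e) = Poly_Mapping.lookup q 0 * Poly_Mapping.lookup b (?m e)"
      if b: "b \<in> B" for q b e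
    proof -
      have "b \<in> genideal ?R B" using b B(2) cring.axioms(1)[OF LSS_ring_cring] ring.genideal_self by blast
      then obtain t where t: "b = (\<Sum>f\<in>E. t f * ?g f)"
        unfolding B(3) comb(2) by (auto simp: combinations_def)
      have "Poly_Mapping.lookup (q * b) (?m e) = (\<Sum>f\<in>E. Poly_Mapping.lookup (q * t f * ?g f) (?m e))"
        by (simp add: t sum_distrib_left lookup_sum mult.assoc)
      also have "\<dots> = (\<Sum>f\<in>E. Poly_Mapping.lookup q 0 *
          (Poly_Mapping.lookup (t f) 0 * Poly_Mapping.lookup (?g f) (?m e)))"
        unfolding lookup_times_edge_gen lookup_times_at_zero by (simp only: mult.assoc)
      also have "\<dots> = Poly_Mapping.lookup q 0 * Poly_Mapping.lookup b (?m e)"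
        unfolding t lookup_sum lookup_times_edge_gen sum_distrib_left ..
      finally show ?thesis .
    qed
    show "enat (card E) \<le> enat (card B)"
    proof (rule ccontr)
      assume "\<not> enat (card E) \<le> enat (card B)"
      then have "card B < card E" by simp
      then obtain c where c: "\<exists>e\<in>E. c e \<noteq> 0"
        "\<And>b. b \<in> B \<Longrightarrow> (\<Sum>e\<in>E. Poly_Mapping.lookup (s e b) 0 * c e) = 0"
        by (rule linear_system_nontrivial[OF fE B(1), of "\<lambda>b e. Poly_Mapping.lookup (s e b) 0"]) (rule that)
      have "c e = 0" if e: "e \<in> E" for e
      proof -
        have "c e = (\<Sum>f\<in>E. if e = f then c f else 0)" using fE e by simp
        also have "\<dots> = (\<Sum>f\<in>E. c f * Poly_Mapping.lookup (?g f) (?m e))"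
          by (rule sum.cong) (use d in \<open>auto simp: lookup_edge_gen 2 e\<close>)
        also have "\<dots> = (\<Sum>f\<in>E. c f * (\<Sum>b\<in>B. Poly_Mapping.lookup (s f b) 0 * Poly_Mapping.lookup b (?m e)))"
          by (rule sum.cong) (simp_all add: s lookup_sum quad del: One_nat_def)
        also have "\<dots> = (\<Sum>b\<in>B. (\<Sum>f\<in>E. Poly_Mapping.lookup (s f b) 0 * c f) * Poly_Mapping.lookup b (?m e))"
          unfolding sum_distrib_left sum_distrib_right by (subst sum.swap) (simp add: mult_ac)
        also have "\<dots> = 0" using c(2) by simp
        finally show ?thesis .
      qed
      then show False using c(1) by blast
    qed
  qed
qed

text \<open>The variable \<open>x\<^bsub>i,l\<^esub>\<close> has weight \<open>w i l\<close>.  The last condition makes \<open>x\<^bsub>i,c\<^esub> x\<^bsub>j,c\<^esub>\<close>, with \<open>c\<close> the colour of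
  \<open>{i, j}\<close>, the initial monomial of the generator of \<open>{i, j}\<close>, and properness of the colouring makes the initial monomials of
  different edges coprime.  Positive matching decompositions of a graph yield such data.\<close>

definition positive_edge_colouring ::
    "nat \<Rightarrow> 'v set set \<Rightarrow> ('v set \<Rightarrow> nat) \<Rightarrow> ('v \<Rightarrow> nat \<Rightarrow> nat) \<Rightarrow> bool" where
  "positive_edge_colouring d E c w \<longleftrightarrow>
     (\<forall>e\<in>E. c e \<in> {1..d}) \<and>
     (\<forall>e\<in>E. \<forall>f\<in>E. e \<noteq> f \<and> e \<inter> f \<noteq> {} \<longrightarrow> c e \<noteq> c f) \<and>
     (\<forall>i j l. {i, j} \<in> E \<and> i \<noteq> j \<and> l \<in> {1..d} \<and> l \<noteq> c {i, j} \<longrightarrow>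
        w i l + w j l < w i (c {i, j}) + w j (c {i, j}))"

theorem ideal_height_ge_positive_edge_colouring:
  assumes G: "simple_graph {1..n} E" and c: "positive_edge_colouring d E c w"
  shows "enat (card E) \<le> ideal_height (LSS_ring n d) (LSS_ideal n E d :: 'k::field mpoly set)"
proof -
  have fE: "finite E" using G finite_subset[of E "Pow {1..n}"] by (auto simp: simple_graph_def)
  have 2: "card e = 2" if "e \<in> E" for e using G that by (simp add: simple_graph_def)
  obtain h where h: "bij_betw h {..<card E} E"
    using ex_bij_betw_nat_finite[OF fE] by (auto simp: atLeast0LessThan)
  have hE: "h i \<in> E" if "i < card E" for i using h that by (auto simp: bij_betw_def)
  let ?f = "\<lambda>i. edge_gen d (h i) :: 'k mpoly" and ?\<mu> = "\<lambda>i. edge_monomial (h i) (c (h i))"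
  let ?w = "\<lambda>(i, l). w i l"
  have "enat (card E) \<le> ideal_height (LSS_ring n d) (genideal (LSS_ring n d) (?f ` {..<card E}))"
  proof (rule ideal_height_ge_coprime_initial_monomials)
    fix i assume i: "i < card E"
    show "?f i \<in> carrier (LSS_ring n d)" by (rule edge_gen_carrier[OF G hE[OF i]])
    note mm = card_2_Min_Max[OF 2[OF hE[OF i]]]
    show "initial_monomial ?w (?f i) (?\<mu> i)"
      unfolding initial_monomial_def
    proof (intro conjI ballI impI)
      show "Poly_Mapping.lookup (?f i) (?\<mu> i) = 1"
        using c hE[OF i] 2 by (simp add: lookup_edge_gen positive_edge_colouring_def)
      fix m assume m: "m \<in> Poly_Mapping.keys (?f i)" "m \<noteq> ?\<mu> i"
      then obtain l where l: "m = edge_monomial (h i) l" "l \<in> {1..d}" "l \<noteq> c (h i)"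
        using keys_edge_gen by blast
      have "{j, k} \<in> E \<Longrightarrow> j \<noteq> k \<Longrightarrow> l \<noteq> c {j, k} \<Longrightarrow>
          w j l + w k l < w j (c {j, k}) + w k (c {j, k})" for j k
        using c l(2) unfolding positive_edge_colouring_def by blast
      from this[of "Min (h i)" "Max (h i)", folded mm(1)]
      show "weight ?w m < weight ?w (?\<mu> i)"
        using l(1,3) mm(2) hE[OF i] by (simp add: weight_edge_monomial)
    qed
  next
    fix i j assume ij: "i < card E" "j < card E" "i \<noteq> j"
    then have "h i \<noteq> h j" using h by (auto simp: bij_betw_def inj_on_def)
    moreover have "\<forall>e\<in>E. \<forall>f\<in>E. e \<noteq> f \<and> e \<inter> f \<noteq> {} \<longrightarrow> c e \<noteq> c f"
      using c by (simp add: positive_edge_colouring_def)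
    ultimately have "h i \<inter> h j = {} \<or> c (h i) \<noteq> c (h j)"
      using hE[OF ij(1)] hE[OF ij(2)] by metis
    then show "Poly_Mapping.keys (?\<mu> i) \<inter> Poly_Mapping.keys (?\<mu> j) = {}"
      unfolding keys_edge_monomial[OF 2[OF hE[OF ij(1)]]] keys_edge_monomial[OF 2[OF hE[OF ij(2)]]]
      by blast
  qed
  also have "?f ` {..<card E} = edge_gen d ` E"
    using h unfolding bij_betw_def by (simp add: image_image[symmetric])
  also have "genideal (LSS_ring n d) \<dots> = LSS_ideal n E d"
    using G by (simp add: LSS_ideal_eq_genideal_edge_gen)
  finally show ?thesis .
qed


section \<open>Counting edges and cycles\<close>

lemma simple_graphD:
  assumes "simple_graph V E"
  shows "finite V" "finite E" "\<Union>E \<subseteq> V" "finite (\<Union>E)" "\<And>e. e \<in> E \<Longrightarrow> card e = 2"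
proof -
  show V: "finite V" and U: "\<Union>E \<subseteq> V" and "\<And>e. e \<in> E \<Longrightarrow> card e = 2"
    using assms by (auto simp: simple_graph_def)
  show "finite E" using finite_subset[of E "Pow V"] U V by auto
  show "finite (\<Union>E)" using U V by (rule finite_subset)
qed

lemma simple_graph_subset: "simple_graph V E \<Longrightarrow> E' \<subseteq> E \<Longrightarrow> simple_graph V E'"
  by (auto simp: simple_graph_def)

lemma simple_graph_edgeE:
  assumes "simple_graph V E" "e \<in> E" "v \<in> e"
  obtains x where "e = {v, x}" "x \<noteq> v"
proof -
  obtain a b where "e = {a, b}" "a \<noteq> b"
    using simple_graphD(5)[OF assms(1,2)] by (auto simp: card_2_iff)
  then show thesis using assms(3) that[of a] that[of b] by (auto simp: insert_commute)
qed

lemma finite_cycle_subgraphs: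
  assumes "simple_graph V E" shows "finite (cycle_subgraphs V E)"
proof (rule finite_subset)
  show "cycle_subgraphs V E \<subseteq> Pow V \<times> Pow E" by (auto simp: cycle_subgraphs_def)
  show "finite (Pow V \<times> Pow E)" using simple_graphD(1,2)[OF assms] by simp
qed

lemma cycle_subgraphs_mono: "E' \<subseteq> E \<Longrightarrow> cycle_subgraphs V E' \<subseteq> cycle_subgraphs V E"
  by (auto simp: cycle_subgraphs_def)

lemma card_cycle_subgraphs_mono:
  "simple_graph V E \<Longrightarrow> E' \<subseteq> E \<Longrightarrow> card (cycle_subgraphs V E') \<le> card (cycle_subgraphs V E)"
  by (intro card_mono finite_cycle_subgraphs cycle_subgraphs_mono)

lemma cycle_subgraphsI:
  assumes "distinct p" "length p \<ge> 3" "set p \<subseteq> V"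
    and "\<And>i. i < length p \<Longrightarrow> {p ! i, p ! (Suc i mod length p)} \<in> E"
  shows "(set p, {{p ! i, p ! (Suc i mod length p)} | i. i < length p}) \<in> cycle_subgraphs V E"
  unfolding cycle_subgraphs_def is_cycle_def using assms by auto

lemma vertex_degree_pos_iff:
  assumes "simple_graph V E" shows "vertex_degree E v > 0 \<longleftrightarrow> v \<in> \<Union>E"
  using simple_graphD(2)[OF assms] by (auto simp: vertex_degree_def card_gt_0_iff)

lemma vertex_degree_eq_card_neighbours:
  assumes "simple_graph V E" shows "vertex_degree E v = card {x. {v, x} \<in> E}"
proof -
  have "{e \<in> E. v \<in> e} = (\<lambda>x. {v, x}) ` {x. {v, x} \<in> E}"
    using simple_graph_edgeE[OF assms] by blast
  moreover have "inj_on (\<lambda>x. {v, x}) {x. {v, x} \<in> E}"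
    by (auto simp: inj_on_def doubleton_eq_iff)
  ultimately show ?thesis by (simp add: vertex_degree_def card_image)
qed

lemma vertex_degree_mono:
  "simple_graph V E \<Longrightarrow> E' \<subseteq> E \<Longrightarrow> vertex_degree E' v \<le> vertex_degree E v"
  unfolding vertex_degree_def by (intro card_mono) (auto dest: simple_graphD(2))

lemma sum_vertex_degree:
  assumes "simple_graph V E"
  shows "(\<Sum>v\<in>\<Union>E. vertex_degree E v) = 2 * card E"
proof -
  note G = simple_graphD[OF assms]
  have "(\<Sum>v\<in>\<Union>E. vertex_degree E v) = (\<Sum>v\<in>\<Union>E. \<Sum>e\<in>E. if v \<in> e then 1 else 0)"
    unfolding vertex_degree_def using G(2)
    by (intro sum.cong) (simp_all add: sum.If_cases Int_def)
  also have "\<dots> = (\<Sum>e\<in>E. \<Sum>v\<in>\<Union>E. if v \<in> e then 1 else 0)" by (rule sum.swap)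
  also have "\<dots> = (\<Sum>e\<in>E. card e)"
  proof (rule sum.cong)
    fix e assume "e \<in> E"
    then have "\<Union>E \<inter> {v. v \<in> e} = e" by auto
    then show "(\<Sum>v\<in>\<Union>E. if v \<in> e then 1 else 0) = card e"
      using G(4) by (simp add: sum.If_cases)
  qed simp
  also have "\<dots> = 2 * card E" using G(5) by simp
  finally show ?thesis .
qed

text \<open>An end of a longest path has a second neighbour, which lies on the path and closes a cycle.\<close>

lemma cycle_of_no_leaf:
  assumes G: "simple_graph V E" and ne: "E \<noteq> {}"
    and deg: "\<And>v. v \<in> \<Union>E \<Longrightarrow> vertex_degree E v \<ge> 2"
  shows "cycle_subgraphs V E \<noteq> {}"
proof -
  define path where "path p \<longleftrightarrow> distinct p \<and> set p \<subseteq> V \<and> length p \<ge> 2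
    \<and> (\<forall>i. Suc i < length p \<longrightarrow> {p ! i, p ! Suc i} \<in> E)" for p
  obtain e where e: "e \<in> E" using ne by blast
  obtain a b where ab: "e = {a, b}" "a \<noteq> b"
    using simple_graphD(5)[OF G e] by (auto simp: card_2_iff)
  have "path [a, b]" using ab e simple_graphD(3)[OF G] by (auto simp: path_def)
  moreover have "length p \<le> card V" if "path p" for p
    using that simple_graphD(1)[OF G] by (metis path_def distinct_card card_mono)
  ultimately obtain p where p: "path p" and max: "\<And>q. path q \<Longrightarrow> length q \<le> length p"
    using ex_has_greatest_nat[of path "[a, b]" length "Suc (card V)"] by (metis le_imp_less_Suc)
  have len: "length p \<ge> 2" using p by (simp add: path_def)
  let ?x = "p ! 0"
  have e0: "{?x, p ! 1} \<in> E" using p by (auto simp: path_def)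
  then have "vertex_degree E ?x \<ge> 2" by (intro deg) auto
  then have "\<not> {z. {?x, z} \<in> E} \<subseteq> {p ! 1}"
    using card_mono[of "{p ! 1}" "{z. {?x, z} \<in> E}"]
    by (auto simp: vertex_degree_eq_card_neighbours[OF G])
  then obtain z where z: "{?x, z} \<in> E" "z \<noteq> p ! 1" by blast
  have zx: "z \<noteq> ?x" using simple_graphD(5)[OF G z(1)] by auto
  have "z \<in> set p"
  proof (rule ccontr)
    assume "z \<notin> set p"
    moreover have "z \<in> V" using z(1) simple_graphD(3)[OF G] by auto
    moreover have "{(z # p) ! i, (z # p) ! Suc i} \<in> E" if "Suc i < length (z # p)" for i
      using that z(1) p by (cases i) (auto simp: path_def insert_commute)
    ultimately have "path (z # p)" using p by (auto simp: path_def)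
    then show False using max by fastforce
  qed
  then obtain k where k: "k < length p" "z = p ! k" by (metis in_set_conv_nth)
  have "k \<noteq> 0" "k \<noteq> 1" using k(2) z(2) zx by metis+
  then have k2: "k \<ge> 2" by simp
  let ?q = "take (Suc k) p"
  have "(set ?q, {{?q ! i, ?q ! (Suc i mod length ?q)} | i. i < length ?q}) \<in> cycle_subgraphs V E"
  proof (rule cycle_subgraphsI)
    show "distinct ?q" "set ?q \<subseteq> V" using p by (auto simp: path_def dest: in_set_takeD)
    show "length ?q \<ge> 3" using k k2 by simp
    fix i assume i: "i < length ?q"
    show "{?q ! i, ?q ! (Suc i mod length ?q)} \<in> E"
    proof (cases "i = k")
      case True
      then show ?thesis using z(1) k by (simp add: insert_commute)
    next
      case False
      then have "i < k" using i by simp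
      then show ?thesis using p k by (simp add: path_def)
    qed
  qed
  then show ?thesis by blast
qed

text \<open>Delete an edge.  The edge at a leaf takes the leaf with it, since \<open>\<Union>E\<close> consists of the vertices that are not isolated.  Without leaves there
  is a cycle, and deleting one of its edges destroys at least that cycle.\<close>

theorem card_edges_le_card_vertices_cycles:
  assumes "simple_graph V E" "E \<noteq> {}"
  shows "card E + 1 \<le> card (\<Union>E) + card (cycle_subgraphs V E)"
  using assms
proof (induction "card E" arbitrary: E rule: less_induct)
  case less
  note G = less.prems(1)
  note fin = simple_graphD[OF G]
  have IH: "card E \<le> card (\<Union>(E - {e})) + card (cycle_subgraphs V (E - {e}))"
    if "e \<in> E" "E - {e} \<noteq> {}" for e
    using less.hyps[OF card_Diff1_less[OF fin(2) that(1)] simple_graph_subset[OF G] that(2)]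
      card_Suc_Diff1[OF fin(2) that(1)] by auto
  show ?case
  proof (cases "\<exists>v\<in>\<Union>E. vertex_degree E v < 2")
    case True
    then obtain v where v: "v \<in> \<Union>E" "vertex_degree E v = 1"
      using vertex_degree_pos_iff[OF G] by (metis One_nat_def less_2_cases less_nat_zero_code)
    then obtain e where e: "{e \<in> E. v \<in> e} = {e}"
      by (auto simp: vertex_degree_def card_1_singleton_iff)
    then have eE: "e \<in> E" "v \<in> e" by auto
    show ?thesis
    proof (cases "E - {e} = {}")
      case True
      then have "E = {e}" using eE by auto
      then show ?thesis using fin(5) by simp
    next
      case False
      have "\<Union>(E - {e}) \<subseteq> \<Union>E - {v}" using e by auto
      then have "card (\<Union>(E - {e})) \<le> card (\<Union>E - {v})" using fin(4) by (intro card_mono) auto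
      moreover have "card (\<Union>E - {v}) + 1 = card (\<Union>E)"
        using card_Suc_Diff1[OF fin(4) v(1)] by simp
      moreover have "card (cycle_subgraphs V (E - {e})) \<le> card (cycle_subgraphs V E)"
        by (rule card_cycle_subgraphs_mono[OF G]) auto
      ultimately show ?thesis using IH[OF eE(1) False] by linarith
    qed
  next
    case False
    then have deg: "vertex_degree E v \<ge> 2" if "v \<in> \<Union>E" for v
      using that False by (meson not_less)
    obtain W F where WF: "(W, F) \<in> cycle_subgraphs V E"
      using cycle_of_no_leaf[OF G less.prems(2) deg] by auto
    then obtain p where p: "length p \<ge> 3" "F = {{p ! i, p ! (Suc i mod length p)} | i. i < length p}"
      by (auto simp: cycle_subgraphs_def is_cycle_def)
    then have "{p ! 0, p ! (Suc 0 mod length p)} \<in> F" by force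
    then obtain e where e: "e \<in> F" "e \<in> E" using WF by (auto simp: cycle_subgraphs_def)
    have "(W, F) \<notin> cycle_subgraphs V (E - {e})" using e by (auto simp: cycle_subgraphs_def)
    then have "cycle_subgraphs V (E - {e}) \<subset> cycle_subgraphs V E"
      using WF cycle_subgraphs_mono[of "E - {e}" E V] by blast
    then have "card (cycle_subgraphs V (E - {e})) < card (cycle_subgraphs V E)"
      using finite_cycle_subgraphs[OF G] by (rule psubset_card_mono[rotated])
    moreover have "E - {e} \<noteq> {}"
    proof
      assume "E - {e} = {}"
      then have E: "E = {e}" using e by auto
      obtain v where v: "v \<in> e" using fin(5)[OF e(2)] by fastforce
      have "vertex_degree E v \<le> card {e}" unfolding vertex_degree_def E by (intro card_mono) auto
      then show False using deg[of v] v e(2) by auto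
    qed
    moreover have "card (\<Union>(E - {e})) \<le> card (\<Union>E)" using fin(4) by (intro card_mono) auto
    ultimately show ?thesis using IH[OF e(2)] by linarith
  qed
qed


section \<open>Extending positive edge colourings\<close>

lemma free_colours:
  assumes "finite F" "card F + k \<le> d"
  shows "card ({1..d} - c ` F) \<ge> k"
proof -
  have "card {1..d} - card (c ` F) \<le> card ({1..d} - c ` F)" by (rule diff_card_le_card_Diff) (use assms in simp)
  then show ?thesis using card_image_le[OF assms(1), of c] assms(2) by simp
qed

lemma positive_edge_colouringI:
  assumes "\<And>e. e \<in> E \<Longrightarrow> c e \<in> {1..d}"
    and "\<And>e f. e \<in> E \<Longrightarrow> f \<in> E \<Longrightarrow> e \<noteq> f \<Longrightarrow> e \<inter> f \<noteq> {} \<Longrightarrow> c e \<noteq> c f"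
    and "\<And>i j l. {i, j} \<in> E \<Longrightarrow> i \<noteq> j \<Longrightarrow> l \<in> {1..d} \<Longrightarrow> l \<noteq> c {i, j} \<Longrightarrow>
        w i l + w j l < w i (c {i, j}) + w j (c {i, j})"
  shows "positive_edge_colouring d E c w"
  unfolding positive_edge_colouring_def
proof (intro conjI ballI allI impI)
  fix e f assume "e \<in> E" "f \<in> E" "e \<noteq> f \<and> e \<inter> f \<noteq> {}"
  then show "c e \<noteq> c f" by (intro assms(2)) simp_all
next
  fix i j l assume "{i, j} \<in> E \<and> i \<noteq> j \<and> l \<in> {1..d} \<and> l \<noteq> c {i, j}"
  then show "w i l + w j l < w i (c {i, j}) + w j (c {i, j})"
    by (elim conjE) (rule assms(3))
qed (rule assms(1))

lemma positive_edge_colouringD: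
  assumes "positive_edge_colouring d E c w"
  shows "e \<in> E \<Longrightarrow> c e \<in> {1..d}"
    and "e \<in> E \<Longrightarrow> f \<in> E \<Longrightarrow> e \<noteq> f \<Longrightarrow> e \<inter> f \<noteq> {} \<Longrightarrow> c e \<noteq> c f"
    and "{i, j} \<in> E \<Longrightarrow> i \<noteq> j \<Longrightarrow> l \<in> {1..d} \<Longrightarrow> l \<noteq> c {i, j} \<Longrightarrow>
        w i l + w j l < w i (c {i, j}) + w j (c {i, j})"
proof -
  note pec = assms[unfolded positive_edge_colouring_def]
  note c = conjunct1[OF pec] conjunct1[OF conjunct2[OF pec]] conjunct2[OF conjunct2[OF pec]]
  show "e \<in> E \<Longrightarrow> c e \<in> {1..d}" using c(1) by (rule bspec)
  show "e \<in> E \<Longrightarrow> f \<in> E \<Longrightarrow> e \<noteq> f \<Longrightarrow> e \<inter> f \<noteq> {} \<Longrightarrow> c e \<noteq> c f"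
    using c(2) by simp
  show "{i, j} \<in> E \<Longrightarrow> i \<noteq> j \<Longrightarrow> l \<in> {1..d} \<Longrightarrow> l \<noteq> c {i, j} \<Longrightarrow>
        w i l + w j l < w i (c {i, j}) + w j (c {i, j})" using c(3) by simp
qed

text \<open>The leaf \<open>v\<close> occurs in no other generator, so its weights are free: a colour that is free at \<open>u\<close> is made
  heavier at \<open>v\<close> than all weights at \<open>u\<close> together.\<close>

lemma positive_edge_colouring_add_leaf:
  assumes G: "simple_graph V E" and e: "{u, v} \<in> E" "vertex_degree E v = 1"
    and deg: "vertex_degree E u \<le> d"
    and c: "positive_edge_colouring d (E - {{u, v}}) c w"
  shows "\<exists>c w. positive_edge_colouring d E c w"
proof -
  let ?e = "{u, v}" and ?E = "E - {{u, v}}"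
  have uv: "u \<noteq> v" using simple_graphD(5)[OF G e(1)] by auto
  obtain g where "{f \<in> E. v \<in> f} = {g}"
    using e(2) unfolding vertex_degree_def by (rule card_1_singletonE)
  moreover have "?e \<in> {f \<in> E. v \<in> f}" using e(1) by simp
  ultimately have "{f \<in> E. v \<in> f} = {?e}" by simp
  then have v: "v \<notin> f" if "f \<in> ?E" for f using that by blast
  let ?F = "{f \<in> ?E. u \<in> f}"
  have fin: "finite {f \<in> E. u \<in> f}" using simple_graphD(2)[OF G] by simp
  have "card ?F < card {f \<in> E. u \<in> f}" using e(1) fin by (intro psubset_card_mono) auto
  then have "card ?F + 1 \<le> d" using deg by (simp add: vertex_degree_def)
  then have "card ({1..d} - c ` ?F) \<ge> 1" by (intro free_colours) (use simple_graphD(2)[OF G] in auto)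
  then have "{1..d} - c ` ?F \<noteq> {}" by (metis card.empty not_one_le_zero)
  then obtain a where a: "a \<in> {1..d}" "\<And>f. f \<in> ?E \<Longrightarrow> u \<in> f \<Longrightarrow> c f \<noteq> a" by blast
  define w' where "w' = w(v := (\<lambda>l. if l = a then Suc (\<Sum>k=1..d. w u k) else 0))"
  have "positive_edge_colouring d E (c(?e := a)) w'"
  proof (rule positive_edge_colouringI)
    fix f assume "f \<in> E"
    then show "(c(?e := a)) f \<in> {1..d}" using positive_edge_colouringD(1)[OF c, of f] a(1) by auto
  next
    fix f g assume fg: "f \<in> E" "g \<in> E" "f \<noteq> g" "f \<inter> g \<noteq> {}"
    consider "f = ?e" "g \<in> ?E" | "g = ?e" "f \<in> ?E" | "f \<in> ?E" "g \<in> ?E" using fg by blast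
    then show "(c(?e := a)) f \<noteq> (c(?e := a)) g"
    proof cases
      case 1
      then show ?thesis using a(2)[of g] v[of g] fg by auto
    next
      case 2
      then show ?thesis using a(2)[of f] v[of f] fg by auto
    next
      case 3
      then show ?thesis using positive_edge_colouringD(2)[OF c 3] fg by auto
    qed
  next
    fix i j l assume ij: "{i, j} \<in> E" "i \<noteq> j" "l \<in> {1..d}" "l \<noteq> (c(?e := a)) {i, j}"
    show "w' i l + w' j l < w' i ((c(?e := a)) {i, j}) + w' j ((c(?e := a)) {i, j})"
    proof (cases "{i, j} = ?e")
      case True
      have "w u l \<le> (\<Sum>k=1..d. w u k)" using ij(3) by (intro member_le_sum) auto
      then show ?thesis using True ij(4) uv by (auto simp: w'_def doubleton_eq_iff)
    next
      case False
      then have E: "{i, j} \<in> ?E" using ij by auto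
      have "w' i = w i" "w' j = w j" using v[OF E] by (auto simp: w'_def)
      then show ?thesis using positive_edge_colouringD(3)[OF c E ij(2,3)] False ij(4) by simp
    qed
  qed
  then show ?thesis by blast
qed

lemma distinct_representatives:
  assumes "card A \<ge> 1" "card B \<ge> 1" "card A \<ge> 2 \<or> card B \<ge> 2"
  obtains a b where "a \<in> A" "b \<in> B" "a \<noteq> b"
proof -
  have fin: "finite A" "finite B" using assms by (auto intro: card_ge_0_finite)
  obtain a b where ab: "a \<in> A" "b \<in> B" using assms(1,2) by fastforce
  show thesis
    using assms(3)
  proof
    assume "card A \<ge> 2"
    then have "\<not> A \<subseteq> {b}" using card_mono[of "{b}" A] by auto
    then show thesis using that ab by blast
  next
    assume "card B \<ge> 2"
    then have "\<not> B \<subseteq> {a}" using card_mono[of "{a}" B] by auto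
    then show thesis using that ab by blast
  qed
qed

text \<open>The path \<open>p - u - v - q\<close> gets colours \<open>a\<close>, \<open>m\<close>, \<open>b\<close>, all different, where \<open>a\<close> is free at \<open>p\<close> and \<open>b\<close> at \<open>q\<close>.  The
  hypothesis on the degrees of \<open>p\<close> and \<open>q\<close> excludes that both have the same single colour left.  With weights
  \<open>M + 1\<close> for \<open>m\<close> and \<open>2 M + 1\<close> for \<open>a\<close> at \<open>u\<close> and for \<open>b\<close> at \<open>v\<close>, the edge \<open>{u, v}\<close> has weight \<open>2 M + 2\<close> at \<open>m\<close> and at most
  \<open>2 M + 1\<close> elsewhere, while at the outer edges the gap \<open>M\<close> outweighs the weights at \<open>p\<close> and \<open>q\<close>.\<close>

lemma positive_edge_colouring_add_path:
  assumes G: "simple_graph V E" and uv: "u \<noteq> v"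
    and u: "{f \<in> E. u \<in> f} = {{u, v}, {p, u}}" "p \<noteq> v" "p \<noteq> u"
    and v: "{f \<in> E. v \<in> f} = {{u, v}, {q, v}}" "q \<noteq> u" "q \<noteq> v"
    and deg: "vertex_degree E p \<le> d" "vertex_degree E q \<le> d"
      "p = q \<or> vertex_degree E p < d \<or> vertex_degree E q < d"
    and d: "d \<ge> 3"
    and c: "positive_edge_colouring d (E - {{u, v}, {p, u}, {q, v}}) c w"
  shows "\<exists>c w. positive_edge_colouring d E c w"
proof -
  let ?E = "E - {{u, v}, {p, u}, {q, v}}"
  note fE = simple_graphD(2)[OF G]
  have pu: "{p, u} \<in> E" and uvE: "{u, v} \<in> E" and qv: "{q, v} \<in> E" using u(1) v(1) by blast+
  have nu: "u \<notin> f" and nv: "v \<notin> f" if "f \<in> ?E" for f using that u(1) v(1) by blast+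
  define A where "A = {1..d} - c ` {f \<in> ?E. p \<in> f}"
  define B where "B = {1..d} - c ` {f \<in> ?E. q \<in> f}"
  have fin: "finite {f \<in> E. x \<in> f}" "finite {f \<in> ?E. x \<in> f}" for x using fE by auto
  have degx: "vertex_degree E x = card {f \<in> E. x \<in> f}" for x by (simp add: vertex_degree_def)
  have AB: "card A \<ge> 1 \<and> card B \<ge> 1 \<and> (card A \<ge> 2 \<or> card B \<ge> 2)"
  proof (cases "p = q")
    case True
    have "{f \<in> E. p \<in> f} = insert {p, u} (insert {p, v} {f \<in> ?E. p \<in> f})"
      using True pu qv u v by auto
    moreover have "{p, u} \<noteq> {p, v}" using uv by (auto simp: doubleton_eq_iff)
    ultimately have "vertex_degree E p = card {f \<in> ?E. p \<in> f} + 2"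
      unfolding degx using True fin by (simp add: insert_commute)
    then have "card {f \<in> ?E. p \<in> f} + 2 \<le> d" using deg by simp
    then have "card A \<ge> 2" unfolding A_def by (intro free_colours) (use fin in auto)
    then show ?thesis using True by (simp add: A_def B_def)
  next
    case False
    have "{f \<in> E. p \<in> f} = insert {p, u} {f \<in> ?E. p \<in> f}"
      using False pu u v by auto
    then have p: "vertex_degree E p = card {f \<in> ?E. p \<in> f} + 1" unfolding degx using fin by simp
    have "{f \<in> E. q \<in> f} = insert {q, v} {f \<in> ?E. q \<in> f}"
      using False qv u v by auto
    then have q: "vertex_degree E q = card {f \<in> ?E. q \<in> f} + 1" unfolding degx using fin by simp
    have "card A \<ge> d - card {f \<in> ?E. p \<in> f}"
      unfolding A_def by (rule free_colours[OF fin(2)]) (use p deg(1) in linarith)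
    moreover have "card B \<ge> d - card {f \<in> ?E. q \<in> f}"
      unfolding B_def by (rule free_colours[OF fin(2)]) (use q deg(2) in linarith)
    ultimately show ?thesis using p q deg False by linarith
  qed
  obtain a b where ab: "a \<in> A" "b \<in> B" "a \<noteq> b"
    using distinct_representatives[of A B] AB by blast
  have "card {a, b} < card {1..d}" using ab(3) d by simp
  then obtain m where m: "m \<in> {1..d}" "m \<noteq> a" "m \<noteq> b"
    by (metis card_mono finite.intros insertCI linorder_not_le subsetI)
  have abd: "a \<in> {1..d}" "b \<in> {1..d}" using ab by (auto simp: A_def B_def)
  have af: "c f \<noteq> a" if "f \<in> ?E" "p \<in> f" for f using that ab(1) unfolding A_def by blast
  have bf: "c f \<noteq> b" if "f \<in> ?E" "q \<in> f" for f using that ab(2) unfolding B_def by blast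
  define M where "M = Suc ((\<Sum>k=1..d. w p k) + (\<Sum>k=1..d. w q k))"
  have wp: "w p l < M" and wq: "w q l < M" if "l \<in> {1..d}" for l
    using member_le_sum[of l "{1..d}" "w p"] member_le_sum[of l "{1..d}" "w q"] that
    by (auto simp: M_def)
  define c' where "c' = c({u, v} := m, {p, u} := a, {q, v} := b)"
  have dist: "{u, v} \<noteq> {p, u}" "{u, v} \<noteq> {q, v}" "{p, u} \<noteq> {q, v}"
    using uv u v by (auto simp: doubleton_eq_iff)
  have c'e: "c' {u, v} = m" "c' {p, u} = a" "c' {q, v} = b" and c'f: "\<And>f. f \<in> ?E \<Longrightarrow> c' f = c f"
    using dist by (auto simp: c'_def)
  define w' where "w' = w(u := (\<lambda>l. if l = m then M + 1 else if l = a then 2 * M + 1 else 0),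
                          v := (\<lambda>l. if l = m then M + 1 else if l = b then 2 * M + 1 else 0))"
  have w'u: "w' u l = (if l = m then M + 1 else if l = a then 2 * M + 1 else 0)"
    and w'v: "w' v l = (if l = m then M + 1 else if l = b then 2 * M + 1 else 0)" for l
    using uv by (auto simp: w'_def)
  have w'x: "w' x = w x" if "x \<noteq> u" "x \<noteq> v" for x using that by (simp add: w'_def)
  have cases: "f = {u, v} \<or> f = {p, u} \<or> f = {q, v} \<or> f \<in> ?E" if "f \<in> E" for f using that by blast
  have "positive_edge_colouring d E c' w'"
  proof (rule positive_edge_colouringI)
    fix f assume "f \<in> E"
    then show "c' f \<in> {1..d}"
      using cases[of f] c'e c'f[of f] positive_edge_colouringD(1)[OF c, of f] abd m(1) by metis
  next
    have *: "c' f \<noteq> c' g"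
      if "f \<in> {{u, v}, {p, u}, {q, v}}" "g \<in> E" "f \<noteq> g" "f \<inter> g \<noteq> {}" for f g
    proof (cases "g \<in> ?E")
      case True
      then show ?thesis using that nu[OF True] nv[OF True] af[OF True] bf[OF True] c'e c'f[OF True] by auto
    next
      case False
      then have "g \<in> {{u, v}, {p, u}, {q, v}}" using that(2) by blast
      then show ?thesis using that(1,3) c'e m ab(3) by auto
    qed
    fix f g assume fg: "f \<in> E" "g \<in> E" "f \<noteq> g" "f \<inter> g \<noteq> {}"
    show "c' f \<noteq> c' g"
    proof (cases "f \<in> {{u, v}, {p, u}, {q, v}}")
      case True
      then show ?thesis using fg(2-4) by (rule *)
    next
      case f: False
      show ?thesis
      proof (cases "g \<in> {{u, v}, {p, u}, {q, v}}")
        case True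
        have "g \<inter> f \<noteq> {}" using fg(4) by (simp add: Int_commute)
        from *[OF True fg(1) fg(3)[symmetric] this] show ?thesis by simp
      next
        case False
        note E = DiffI[OF fg(1) f] DiffI[OF fg(2) False]
        show ?thesis unfolding c'f[OF E(1)] c'f[OF E(2)]
          by (rule positive_edge_colouringD(2)[OF c E fg(3,4)])
      qed
    qed
  next
    fix i j l assume ij: "{i, j} \<in> E" "i \<noteq> j" "l \<in> {1..d}" "l \<noteq> c' {i, j}"
    have swap: "w' i l + w' j l < w' i k + w' j k"
      if "{i, j} = {x, y}" "w' x l + w' y l < w' x k + w' y k" for x y k
      using that by (auto simp: doubleton_eq_iff add.commute)
    show "w' i l + w' j l < w' i (c' {i, j}) + w' j (c' {i, j})"
      using cases[OF ij(1)]
    proof (elim disjE)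
      assume eq: "{i, j} = {u, v}"
      then have "c' {i, j} = m" by (simp add: c'e)
      then show ?thesis using ij(4) m ab(3) by (intro swap[OF eq]) (auto simp: w'u w'v)
    next
      assume eq: "{i, j} = {p, u}"
      then have "c' {i, j} = a" by (simp add: c'e)
      then show ?thesis using ij(4) m wp[OF ij(3)] u(2,3)
        by (intro swap[OF eq]) (auto simp: w'u w'x)
    next
      assume eq: "{i, j} = {q, v}"
      then have "c' {i, j} = b" by (simp add: c'e)
      then show ?thesis using ij(4) m wq[OF ij(3)] v(2,3)
        by (intro swap[OF eq]) (auto simp: w'v w'x)
    next
      assume E: "{i, j} \<in> ?E"
      then have "w' i = w i" "w' j = w j" using nu[OF E] nv[OF E] by (auto intro!: w'x)
      then show ?thesis using positive_edge_colouringD(3)[OF c E ij(2,3)] c'f[OF E] ij(4) by simp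
    qed
  qed
  then show ?thesis by blast
qed


section \<open>Graphs with at most two cycles\<close>

lemma card_2_obtain_other:
  assumes "card N = 2" "x \<in> N" obtains y where "N = {x, y}" "y \<noteq> x"
proof -
  obtain a b where "N = {a, b}" "a \<noteq> b" using assms(1) by (auto simp: card_2_iff)
  then show thesis using assms(2) that[of a] that[of b] by (auto simp: insert_commute)
qed

lemma three_cycles:
  assumes G: "simple_graph V E"
    and W: "W1 \<in> fst ` cycle_subgraphs V E" "W2 \<in> fst ` cycle_subgraphs V E"
      "W3 \<in> fst ` cycle_subgraphs V E" "W1 \<noteq> W2" "W1 \<noteq> W3" "W2 \<noteq> W3"
  shows "card (cycle_subgraphs V E) \<ge> 3"
proof -
  have "3 = card {W1, W2, W3}" using W(4-6) by simp
  also have "\<dots> \<le> card (fst ` cycle_subgraphs V E)"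
    by (rule card_mono) (use W(1-3) finite_cycle_subgraphs[OF G] in auto)
  also have "\<dots> \<le> card (cycle_subgraphs V E)" by (rule card_image_le[OF finite_cycle_subgraphs[OF G]])
  finally show ?thesis .
qed

lemma triangle_cycle:
  assumes G: "simple_graph V E" and "distinct [x, y, z]" "{x, y} \<in> E" "{y, z} \<in> E" "{z, x} \<in> E"
  shows "{x, y, z} \<in> fst ` cycle_subgraphs V E"
proof -
  have "(set [x, y, z], {{[x, y, z] ! i, [x, y, z] ! (Suc i mod length [x, y, z])} | i. i < length [x, y, z]})
      \<in> cycle_subgraphs V E"
    using assms simple_graphD(3)[OF G]
    by (intro cycle_subgraphsI) (auto simp: less_Suc_eq)
  from imageI[OF this, of fst] show ?thesis by simp
qed

lemma square_cycle:
  assumes G: "simple_graph V E" and "distinct [x, y, z, t]"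
    "{x, y} \<in> E" "{y, z} \<in> E" "{z, t} \<in> E" "{t, x} \<in> E"
  shows "{x, y, z, t} \<in> fst ` cycle_subgraphs V E"
proof -
  have "(set [x, y, z, t], {{[x, y, z, t] ! i, [x, y, z, t] ! (Suc i mod length [x, y, z, t])}
      | i. i < length [x, y, z, t]}) \<in> cycle_subgraphs V E"
    using assms simple_graphD(3)[OF G]
    by (intro cycle_subgraphsI) (auto simp: less_Suc_eq)
  from imageI[OF this, of fst] show ?thesis by simp
qed

text \<open>The degrees add up to twice the number of edges, which the number of cycles bounds.\<close>

lemma sum_excess_le:
  assumes G: "simple_graph V E" "E \<noteq> {}"
    and deg: "\<And>v. v \<in> \<Union>E \<Longrightarrow> vertex_degree E v \<ge> 2"
  shows "(\<Sum>v\<in>\<Union>E. vertex_degree E v - 2) + 2 \<le> 2 * card (cycle_subgraphs V E)"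
proof -
  have "(\<Sum>v\<in>\<Union>E. vertex_degree E v - 2) + (\<Sum>v\<in>\<Union>E. 2) = (\<Sum>v\<in>\<Union>E. vertex_degree E v)"
    unfolding sum.distrib[symmetric] by (intro sum.cong refl le_add_diff_inverse2 deg)
  then show ?thesis
    using sum_vertex_degree[OF G(1)] card_edges_le_card_vertices_cycles[OF G] by simp
qed

text \<open>The excess of the degrees over \<open>2\<close> adds up to at most \<open>2\<close>, so at most two vertices have degree greater than \<open>2\<close>.  If every
  edge had such an end, then there would be exactly two of them, \<open>a\<close> and \<open>b\<close>, and all other vertices
  would be adjacent to precisely \<open>a\<close> and \<open>b\<close>.  Together with a third neighbour of \<open>a\<close> this is a theta graph, which has three cycles.\<close>

lemma adjacent_vertices_of_degree_two:
  assumes G: "simple_graph V E" "E \<noteq> {}"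
    and deg: "\<And>v. v \<in> \<Union>E \<Longrightarrow> vertex_degree E v \<ge> 2"
    and cyc: "card (cycle_subgraphs V E) \<le> 2"
  obtains u v where "{u, v} \<in> E" "vertex_degree E u = 2" "vertex_degree E v = 2"
proof (rule ccontr)
  assume neg: "\<not> thesis"
  note found = that
  note fin = simple_graphD(4)[OF G(1)]
  let ?D = "vertex_degree E" and ?N = "\<lambda>v. {x. {v, x} \<in> E}"
  have cN: "card (?N v) = ?D v" for v by (simp add: vertex_degree_eq_card_neighbours[OF G(1)])
  have sym: "{x, y} \<in> E \<longleftrightarrow> {y, x} \<in> E" for x y by (simp add: insert_commute)
  have irr: "x \<noteq> y" if "{x, y} \<in> E" for x y using simple_graphD(5)[OF G(1) that] by auto
  define Hi where "Hi = {v \<in> \<Union>E. ?D v \<ge> 3}"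
  have D2: "?D v = 2" if "v \<in> \<Union>E" "v \<notin> Hi" for v
    using deg[OF that(1)] that by (auto simp: Hi_def)
  have end_Hi: "u \<in> Hi \<or> v \<in> Hi" if "{u, v} \<in> E" for u v
  proof (rule ccontr)
    assume "\<not> (u \<in> Hi \<or> v \<in> Hi)"
    moreover have "u \<in> \<Union>E" "v \<in> \<Union>E" using that by auto
    ultimately have "?D u = 2" "?D v = 2" using D2 by auto
    then show False using neg found[OF that] by blast
  qed
  have HiE: "Hi \<subseteq> \<Union>E" by (auto simp: Hi_def)
  then have fHi: "finite Hi" using fin by (rule finite_subset)
  have "(\<Sum>v\<in>Hi. 1) \<le> (\<Sum>v\<in>Hi. ?D v - 2)"
    by (rule sum_mono) (auto simp: Hi_def)
  then have "card Hi \<le> (\<Sum>v\<in>Hi. ?D v - 2)" by simp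
  also have "\<dots> \<le> (\<Sum>v\<in>\<Union>E. ?D v - 2)" using HiE fin by (intro sum_mono2) auto
  finally have cHi: "card Hi \<le> 2" using sum_excess_le[OF G deg] cyc by simp
  obtain v where v: "v \<in> \<Union>E" "v \<notin> Hi"
  proof (rule ccontr)
    assume "\<not> thesis"
    then have all: "\<Union>E \<subseteq> Hi" using that by blast
    obtain e where e: "e \<in> E" using G(2) by blast
    then have "e \<noteq> {}" using simple_graphD(5)[OF G(1) e] by auto
    then obtain x where x: "x \<in> \<Union>E" using e by blast
    have "?N x \<subseteq> Hi" using all by auto
    from card_mono[OF fHi this] have "?D x \<le> 2" using cHi cN[of x] by simp
    then show False using all x by (auto simp: Hi_def)
  qed
  obtain a b where ab: "?N v = {a, b}" "a \<noteq> b"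
    using cN[of v] D2[OF v] by (auto simp: card_2_iff)
  have va: "{v, a} \<in> E" and vb: "{v, b} \<in> E" using ab(1) by auto
  have "{a, b} \<subseteq> Hi" using end_Hi[OF va] end_Hi[OF vb] v(2) by auto
  then have Hi: "Hi = {a, b}" using card_seteq[OF fHi, of "{a, b}"] cHi ab(2) by simp
  have N: "?N z = {a, b}" if "z \<in> \<Union>E" "z \<noteq> a" "z \<noteq> b" for z
  proof (rule card_seteq)
    show "?N z \<subseteq> {a, b}" using end_Hi that Hi by auto
    show "card {a, b} \<le> card (?N z)" using cN[of z] D2[OF that(1)] that(2,3) Hi ab(2) by simp
  qed simp
  have vab: "v \<noteq> a" "v \<noteq> b" using irr va vb by auto
  have "card (?N a) \<ge> 3" using Hi cN by (auto simp: Hi_def)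
  then have "\<not> ?N a \<subseteq> {v, b}" using card_mono[of "{v, b}" "?N a"] vab by auto
  then obtain z where z: "{a, z} \<in> E" "z \<noteq> v" "z \<noteq> b" by blast
  have za: "z \<noteq> a" using irr[OF z(1)] by simp
  have zb: "{z, b} \<in> E" using N[of z] z za by auto
  have "\<not> ?N a \<subseteq> {v, z}" using card_mono[of "{v, z}" "?N a"] \<open>card (?N a) \<ge> 3\<close> z(2) by auto
  then obtain y where y: "{a, y} \<in> E" "y \<noteq> v" "y \<noteq> z" by blast
  have ya: "y \<noteq> a" using irr[OF y(1)] by simp
  have sq: "{a, s, b, t} \<in> fst ` cycle_subgraphs V E"
    if "{a, s} \<in> E" "{s, b} \<in> E" "{a, t} \<in> E" "{t, b} \<in> E" "s \<noteq> t" for s t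
    by (rule square_cycle[OF G(1)]) (use that irr ab(2) in \<open>auto simp: insert_commute\<close>)
  have "card (cycle_subgraphs V E) \<ge> 3"
  proof (cases "y = b")
    case True
    have tri: "{a, s, b} \<in> fst ` cycle_subgraphs V E" if "{a, s} \<in> E" "{s, b} \<in> E" for s
      by (rule triangle_cycle[OF G(1)]) (use that irr ab(2) y(1) True in \<open>auto simp: insert_commute\<close>)
    show ?thesis
      by (rule three_cycles[OF G(1) tri[of v] tri[of z] sq[of v z]])
        (use va vb z zb za vab in \<open>auto simp: insert_commute\<close>)
  next
    case False
    then have yb: "{y, b} \<in> E" using N[of y] y ya by auto
    show ?thesis
      by (rule three_cycles[OF G(1) sq[of v z] sq[of v y] sq[of z y]])
        (use va vb z zb za vab y yb ya False in \<open>auto simp: insert_commute\<close>)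
  qed
  then show False using cyc by simp
qed

text \<open>Passing to a subgraph creates no cycles and does not increase degrees, so leaves and paths through two adjacent vertices of degree
  two can be removed by induction.\<close>

theorem exists_positive_edge_colouring:
  assumes "simple_graph V E" "\<And>v. vertex_degree E v \<le> d" "d \<ge> 3"
    and "card (cycle_subgraphs V E) \<le> 2" "card (cycle_subgraphs V E) + 2 \<le> d"
  shows "\<exists>c w. positive_edge_colouring d E c w"
  using assms
proof (induction "card E" arbitrary: E rule: less_induct)
  case less
  note G = less.prems(1)
  have IH: "\<exists>c w. positive_edge_colouring d (E - F) c w" if "F \<subseteq> E" "F \<noteq> {}" for F
  proof (rule less.hyps)
    show "card (E - F) < card E"
      using that simple_graphD(2)[OF G] by (intro psubset_card_mono) auto
    show "simple_graph V (E - F)" by (rule simple_graph_subset[OF G]) auto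
    have "card (cycle_subgraphs V (E - F)) \<le> card (cycle_subgraphs V E)"
      by (rule card_cycle_subgraphs_mono[OF G]) auto
    then show "card (cycle_subgraphs V (E - F)) \<le> 2" "card (cycle_subgraphs V (E - F)) + 2 \<le> d"
      using less.prems(4,5) by simp_all
    show "vertex_degree (E - F) v \<le> d" for v
      using vertex_degree_mono[OF G, of "E - F" v] less.prems(2)[of v] by simp
  qed (rule less.prems(3))
  show ?case
  proof (cases "\<exists>v\<in>\<Union>E. vertex_degree E v < 2")
    case True
    then obtain v where v: "v \<in> \<Union>E" "vertex_degree E v < 2" by blast
    then have v1: "vertex_degree E v = 1" using vertex_degree_pos_iff[OF G, of v] by simp
    obtain e where e: "e \<in> E" "v \<in> e" using v(1) by blast
    obtain u where "e = {v, u}" using simple_graph_edgeE[OF G e] by blast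
    then have uv: "{u, v} \<in> E" using e(1) by (simp add: insert_commute)
    obtain c w where "positive_edge_colouring d (E - {{u, v}}) c w" using IH[of "{{u, v}}"] uv by blast
    then show ?thesis by (rule positive_edge_colouring_add_leaf[OF G uv v1 less.prems(2)])
  next
    case no_leaf: False
    show ?thesis
    proof (cases "E = {}")
      case True
      then show ?thesis by (intro exI) (simp add: positive_edge_colouring_def)
    next
      case False
      have deg: "vertex_degree E v \<ge> 2" if "v \<in> \<Union>E" for v
        using no_leaf that by (meson not_less)
      obtain u v where uv: "{u, v} \<in> E" "vertex_degree E u = 2" "vertex_degree E v = 2"
        by (rule adjacent_vertices_of_degree_two[OF G False deg less.prems(4)], assumption, rule that)
      have irr: "x \<noteq> y" if "{x, y} \<in> E" for x y using simple_graphD(5)[OF G that] by auto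
      have star: "\<exists>p. {f \<in> E. x \<in> f} = {{u, v}, {p, x}} \<and> p \<noteq> u \<and> p \<noteq> v"
        if x: "x \<in> {u, v}" "vertex_degree E x = 2" for x
      proof -
        have "card {f \<in> E. x \<in> f} = 2" using x(2) by (simp add: vertex_degree_def)
        then obtain f where f: "{f \<in> E. x \<in> f} = {{u, v}, f}" "f \<noteq> {u, v}"
          by (rule card_2_obtain_other[of _ "{u, v}"]) (use x(1) uv(1) in auto)
        then have "f \<in> E" "x \<in> f" by blast+
        then obtain p where p: "f = {x, p}" "p \<noteq> x" by (rule simple_graph_edgeE[OF G])
        then have "p \<noteq> u \<and> p \<noteq> v" using x(1) f(2) by (auto simp: insert_commute)
        then show ?thesis using f(1) p(1) by (auto simp: insert_commute)
      qed
      obtain p where p: "{f \<in> E. u \<in> f} = {{u, v}, {p, u}}" "p \<noteq> u" "p \<noteq> v"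
        using star[of u] uv(2) by auto
      obtain q where q: "{f \<in> E. v \<in> f} = {{u, v}, {q, v}}" "q \<noteq> u" "q \<noteq> v"
        using star[of v] uv(3) by auto
      have pu: "{p, u} \<in> E" and qv: "{q, v} \<in> E" using p(1) q(1) by blast+
      \<comment> \<open>Otherwise \<open>p\<close> and \<open>q\<close> alone would have excess \<open>2 (d - 2)\<close>, more than the number of cycles permits.\<close>
      have pq: "p = q \<or> vertex_degree E p < d \<or> vertex_degree E q < d"
      proof (rule ccontr)
        assume "\<not> ?thesis"
        then have "p \<noteq> q" "vertex_degree E p \<ge> d" "vertex_degree E q \<ge> d" by auto
        moreover have "(\<Sum>v\<in>{p, q}. vertex_degree E v - 2) \<le> (\<Sum>v\<in>\<Union>E. vertex_degree E v - 2)"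
          using pu qv simple_graphD(4)[OF G] by (intro sum_mono2) auto
        ultimately have "2 * (d - 2) \<le> (\<Sum>v\<in>\<Union>E. vertex_degree E v - 2)" by simp
        then show False using sum_excess_le[OF G False deg] less.prems(5) by simp
      qed
      obtain c w where "positive_edge_colouring d (E - {{u, v}, {p, u}, {q, v}}) c w"
        using IH[of "{{u, v}, {p, u}, {q, v}}"] uv(1) pu qv by blast
      then show ?thesis
        by (rule positive_edge_colouring_add_path[OF G irr[OF uv(1)] p(1,3,2) q(1,2,3)
              less.prems(2) less.prems(2) pq less.prems(3)])
    qed
  qed
qed


section \<open>Unicyclic and bicyclic graphs\<close>

lemma ideal_height_LSS_ideal_le_card_edges:
  assumes "simple_graph {1..n} E"
  shows "ideal_height (LSS_ring n d) (LSS_ideal n E d :: 'k::field mpoly set) \<le> enat (card E)"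
  using ideal_height_LSS_ideal_le[OF assms, of "{}" d] by simp

text \<open>Sending \<open>v\<close> to the zero vector costs \<open>d\<close> variables and saves the more than \<open>d\<close> edges at \<open>v\<close>.\<close>

lemma ideal_height_LSS_ideal_less_card_edges:
  assumes G: "simple_graph {1..n} E" and v: "v \<in> {1..n}" "d < vertex_degree E v"
  shows "ideal_height (LSS_ring n d) (LSS_ideal n E d :: 'k::field mpoly set) < enat (card E)"
proof -
  have fE: "finite E" by (rule simple_graphD(2)[OF G])
  have eq: "{e \<in> E. e \<inter> {v} = {}} = E - {e \<in> E. v \<in> e}" by auto
  have "card {e \<in> E. e \<inter> {v} = {}} = card E - vertex_degree E v"
    unfolding eq vertex_degree_def using fE by (intro card_Diff_subset) auto
  moreover have "vertex_degree E v \<le> card E"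
    unfolding vertex_degree_def using fE by (intro card_mono) auto
  ultimately have "d + card {e \<in> E. e \<inter> {v} = {}} < card E" using v(2) by simp
  moreover have "ideal_height (LSS_ring n d) (LSS_ideal n E d :: 'k mpoly set)
      \<le> enat (d + card {e \<in> E. e \<inter> {v} = {}})"
    using ideal_height_LSS_ideal_le[OF G, of "{v}" d] v(1) by simp
  ultimately show ?thesis using enat_ord_simps(2) order_le_less_trans by blast
qed

theorem complete_intersection_LSS_iff:
  assumes G: "simple_graph {1..n} E" and d: "d \<ge> 3"
    and cyc: "0 < card (cycle_subgraphs {1..n} E)" "card (cycle_subgraphs {1..n} E) \<le> 2"
      "card (cycle_subgraphs {1..n} E) + 2 \<le> d"
  shows "complete_intersection (LSS_ring n d) (LSS_ideal n E d :: 'k::field mpoly set)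
           \<longleftrightarrow> max_degree {1..n} E \<le> d"
proof -
  let ?R = "LSS_ring n d :: 'k mpoly ring" and ?I = "LSS_ideal n E d :: 'k mpoly set"
  have CI: "complete_intersection ?R ?I \<longleftrightarrow> enat (card E) = ideal_height ?R ?I"
  proof -
    have "ideal ?I ?R" by (rule LSS_ideal_is_ideal[OF G])
    moreover have "min_num_generators ?R ?I = enat (card E)"
      by (rule min_num_generators_LSS_ideal[OF G]) (use d in simp)
    ultimately show ?thesis by (simp add: complete_intersection_def)
  qed
  have "{1..n} \<noteq> {}"
  proof
    assume empty: "{1..n} = {}"
    have "(W, F) \<notin> cycle_subgraphs {1..n} E" for W F
      unfolding cycle_subgraphs_def is_cycle_def empty by auto
    then have "cycle_subgraphs {1..n} E = {}" by auto
    then show False using cyc(1) by simp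
  qed
  then have max: "max_degree {1..n} E \<le> d \<longleftrightarrow> (\<forall>v\<in>{1..n}. vertex_degree E v \<le> d)"
    unfolding max_degree_def by (subst Max_le_iff) auto
  show ?thesis
  proof
    assume "complete_intersection ?R ?I"
    then have "\<not> ideal_height ?R ?I < enat (card E)" by (simp add: CI)
    then show "max_degree {1..n} E \<le> d"
      unfolding max using ideal_height_LSS_ideal_less_card_edges[OF G, of _ d, where ?'k = 'k] by (meson not_less)
  next
    assume "max_degree {1..n} E \<le> d"
    then have deg: "vertex_degree E v \<le> d" if "v \<in> {1..n}" for v using that max by blast
    have "vertex_degree E v \<le> d" for v
      using deg[of v] vertex_degree_pos_iff[OF G, of v] simple_graphD(3)[OF G] by (cases "v \<in> {1..n}") auto
    then obtain c w where "positive_edge_colouring d E c w"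
      using exists_positive_edge_colouring[OF G _ d cyc(2,3)] by blast
    then show "complete_intersection ?R ?I" unfolding CI
      by (intro antisym ideal_height_ge_positive_edge_colouring[OF G]
          ideal_height_LSS_ideal_le_card_edges[OF G])
  qed
qed

theorem theorem0p1:
  fixes n d :: nat and E :: "nat set set"
  assumes "simple_graph {1..n} E" and "d > 0"
  shows "(unicyclic {1..n} E \<and> d \<ge> 3 \<longrightarrow>
            (complete_intersection (LSS_ring n d) (LSS_ideal n E d :: 'k::field mpoly set)
              \<longleftrightarrow> d \<ge> max_degree {1..n} E))
       \<and> (bicyclic {1..n} E \<and> d \<ge> 4 \<longrightarrow>
            (complete_intersection (LSS_ring n d) (LSS_ideal n E d :: 'k mpoly set)
              \<longleftrightarrow> d \<ge> max_degree {1..n} E))"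
  unfolding unicyclic_def bicyclic_def
  using complete_intersection_LSS_iff[OF assms(1), of d, where ?'k = 'k] by simp

end
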